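(* Let $G$ be a compact group and let $1<p,q<\infty$ with $\frac1p+\frac1q=1$. Then for any $H_1,H_2\in\ell_{sch}^{p}(\widehat{G})$, writing $\|\cdot\|$ for $\|\cdot\|_{\ell_{sch}^{p}(\widehat{G})}$, the following hold. (i) If $1<p\le 2$, then $$\Big(\Big\|\frac{H_1+H_2}{2}\Big\|^{q}+\Big\|\frac{H_1-H_2}{2}\Big\|^{q}\Big)^{1/q}\le\Big(\frac12\big(\|H_1\|^{p}+\|H_2\|^{p}\big)\Big)^{1/p}.$$ (ii) If $2\le p<\infty$, then $$\Big(\Big\|\frac{H_1+H_2}{2}\Big\|^{p}+\Big\|\frac{H_1-H_2}{2}\Big\|^{p}\Big)^{1/p}\le\Big(\frac12\big(\|H_1\|^{q}+\|H_2\|^{q}\big)\Big)^{1/q}.$$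
   Context: $G$ is a compact topological group. $\widehat{G}$ is its unitary dual, the set of equivalence classes $[\xi]$ of strongly continuous irreducible unitary representations $\xi:G\to\mathcal{U}(\mathcal{H}_\xi)$; one representative is fixed per class. Each $\mathcal{H}_\xi$ is a finite-dimensional complex Hilbert space and $\dim(\xi):=\dim(\mathcal{H}_\xi)$. $\mathcal{M}(\widehat{G})$ is the complex vector space (pointwise operations) of all maps $H$ assigning to each $[\xi]\in\widehat{G}$ a linear operator $H(\xi)\in\mathcal{L}(\mathcal{H}_\xi)$. For $1\le p<\infty$, $\|A\|_{\mathcal{S}^p(\mathcal{H}_\xi)}=(\mathrm{Tr}(|A|^p))^{1/p}$ is the Schatten norm, and $\ell_{sch}^{p}(\widehat{G})$ is the Banach space of all $H\in\mathcal{M}(\widehat{G})$ with $$\|H\|_{\ell_{sch}^{p}(\widehat{G})}:=\Big(\sum_{[\xi]\in\widehat{G}}\dim(\xi)\,\|H(\xi)\|_{\mathcal{S}^{p}(\mathcal{H}_{\xi})}^{p}\Big)^{1/p}<\infty.$$ *)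

theory Defs
  imports "HOL-Analysis.Infinite_Sum" "HOL-Analysis.Product_Topology"
    "Jordan_Normal_Form.Schur_Decomposition"
begin

section \<open>Matrices: unitary group, functional calculus, Schatten norms\<close>

definition unitary_group :: "nat \<Rightarrow> complex mat monoid" where
  "unitary_group n = \<lparr>carrier = {U \<in> carrier_mat n n. U * mat_adjoint U = 1\<^sub>m n},
                      mult = (*), one = 1\<^sub>m n\<rparr>"

definition mat_trace :: "complex mat \<Rightarrow> complex" where
  "mat_trace A = sum_list (diag_mat A)"

text \<open>The functional calculus \<open>f(A)\<close> of a Hermitian matrix: if \<open>A = U diag(d) U*\<close> with \<open>U\<close> unitary
  and \<open>d\<close> real, then \<open>f(A) = U diag(f d) U*\<close>. Such a diagonalization exists by the spectral theorem,
  and the result does not depend on its choice.\<close>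

definition herm_fun :: "(real \<Rightarrow> real) \<Rightarrow> complex mat \<Rightarrow> complex mat" where
  "herm_fun f A = (THE B. \<exists>U \<in> carrier (unitary_group (dim_row A)). \<exists>d :: nat \<Rightarrow> real.
     A = U * mat_diag (dim_row A) (\<lambda>i. of_real (d i)) * mat_adjoint U \<and>
     B = U * mat_diag (dim_row A) (\<lambda>i. of_real (f (d i))) * mat_adjoint U)"

definition mat_abs :: "complex mat \<Rightarrow> complex mat" where
  "mat_abs A = herm_fun sqrt (mat_adjoint A * A)"

definition schatten_norm :: "real \<Rightarrow> complex mat \<Rightarrow> real" where
  "schatten_norm p A = Re (mat_trace (herm_fun (\<lambda>t. t powr p) (mat_abs A))) powr (1 / p)"

section \<open>The unitary dual of a compact group\<close>

text \<open>The Hausdorff axiom is not required.\<close>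

locale compact_topological_group = group G
  for G :: "('g, 'm) monoid_scheme" (structure) and T :: "'g topology" +
  assumes topspace_eq: "topspace T = carrier G"
    and compact: "compact_space T"
    and continuous_mult: "continuous_map (prod_topology T T) T (\<lambda>(x, y). x \<otimes> y)"
    and continuous_inv: "continuous_map T T (\<lambda>x. inv x)"

text \<open>Irreducible unitary representations of a compact group are finite-dimensional, so up to the
  choice of an orthonormal basis the representation space is \<open>\<complex>\<^sup>n\<close> and a representation is a
  function with values in the unitary matrices. Strong continuity (continuity of \<open>x \<mapsto> \<xi>(x)v\<close> for
  each \<open>v\<close>) is expressed through the coordinates of \<open>\<xi>(x)v\<close>.\<close>

definition unitary_rep ::
  "('g, 'm) monoid_scheme \<Rightarrow> 'g topology \<Rightarrow> nat \<Rightarrow> ('g \<Rightarrow> complex mat) \<Rightarrow> bool" where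
  "unitary_rep G T n \<xi> \<longleftrightarrow> \<xi> \<in> hom G (unitary_group n) \<and>
     (\<forall>v \<in> carrier_vec n. \<forall>i < n. continuous_map T euclidean (\<lambda>x. (\<xi> x *\<^sub>v v) $ i))"

definition irreducible_rep ::
  "('g, 'm) monoid_scheme \<Rightarrow> nat \<Rightarrow> ('g \<Rightarrow> complex mat) \<Rightarrow> bool" where
  "irreducible_rep G n \<xi> \<longleftrightarrow> n > 0 \<and>
     (\<forall>W. VectorSpace.subspace class_ring W (module_vec TYPE(complex) n) \<longrightarrow>
          (\<forall>x \<in> carrier G. \<forall>w \<in> W. \<xi> x *\<^sub>v w \<in> W) \<longrightarrow>
          W = {0\<^sub>v n} \<or> W = carrier_vec n)"

definition rep_dim :: "('g, 'm) monoid_scheme \<Rightarrow> ('g \<Rightarrow> complex mat) \<Rightarrow> nat" where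
  "rep_dim G \<xi> = dim_row (\<xi> \<one>\<^bsub>G\<^esub>)"

definition irreps :: "('g, 'm) monoid_scheme \<Rightarrow> 'g topology \<Rightarrow> ('g \<Rightarrow> complex mat) set" where
  "irreps G T = {\<xi>. unitary_rep G T (rep_dim G \<xi>) \<xi> \<and> irreducible_rep G (rep_dim G \<xi>) \<xi>}"

definition rep_equiv ::
  "('g, 'm) monoid_scheme \<Rightarrow> 'g topology \<Rightarrow> (('g \<Rightarrow> complex mat) \<times> ('g \<Rightarrow> complex mat)) set" where
  "rep_equiv G T = {(\<xi>, \<eta>). \<xi> \<in> irreps G T \<and> \<eta> \<in> irreps G T \<and> rep_dim G \<xi> = rep_dim G \<eta> \<and>
     (\<exists>U \<in> carrier (unitary_group (rep_dim G \<xi>)). \<forall>x \<in> carrier G. U * \<xi> x = \<eta> x * U)}"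

definition unitary_dual ::
  "('g, 'm) monoid_scheme \<Rightarrow> 'g topology \<Rightarrow> ('g \<Rightarrow> complex mat) set set" where
  "unitary_dual G T = irreps G T // rep_equiv G T"

definition rep_choice ::
  "('g, 'm) monoid_scheme \<Rightarrow> 'g topology \<Rightarrow>
   (('g \<Rightarrow> complex mat) set \<Rightarrow> ('g \<Rightarrow> complex mat)) \<Rightarrow> bool" where
  "rep_choice G T \<rho> \<longleftrightarrow> (\<forall>c \<in> unitary_dual G T. \<rho> c \<in> c)"

section \<open>The spaces \<open>M\<close> and \<open>\<ell>\<^sup>p\<close> on the dual\<close>

type_synonym 'g dual_map = "('g \<Rightarrow> complex mat) set \<Rightarrow> complex mat"

definition dual_maps ::
  "('g, 'm) monoid_scheme \<Rightarrow> 'g topology \<Rightarrow>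
   (('g \<Rightarrow> complex mat) set \<Rightarrow> ('g \<Rightarrow> complex mat)) \<Rightarrow> 'g dual_map set" where
  "dual_maps G T \<rho> =
     (\<Pi>\<^sub>E c \<in> unitary_dual G T. carrier_mat (rep_dim G (\<rho> c)) (rep_dim G (\<rho> c)))"

definition dual_add ::
  "('g, 'm) monoid_scheme \<Rightarrow> 'g topology \<Rightarrow> 'g dual_map \<Rightarrow> 'g dual_map \<Rightarrow> 'g dual_map" where
  "dual_add G T H\<^sub>1 H\<^sub>2 = (\<lambda>c \<in> unitary_dual G T. H\<^sub>1 c + H\<^sub>2 c)"

definition dual_diff ::
  "('g, 'm) monoid_scheme \<Rightarrow> 'g topology \<Rightarrow> 'g dual_map \<Rightarrow> 'g dual_map \<Rightarrow> 'g dual_map" where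
  "dual_diff G T H\<^sub>1 H\<^sub>2 = (\<lambda>c \<in> unitary_dual G T. H\<^sub>1 c - H\<^sub>2 c)"

definition dual_scale ::
  "('g, 'm) monoid_scheme \<Rightarrow> 'g topology \<Rightarrow> complex \<Rightarrow> 'g dual_map \<Rightarrow> 'g dual_map" where
  "dual_scale G T a H = (\<lambda>c \<in> unitary_dual G T. a \<cdot>\<^sub>m H c)"

text \<open>Powers of extended nonnegative reals, used for exponents \<open>a > 0\<close> only.\<close>

definition ennreal_powr :: "ennreal \<Rightarrow> real \<Rightarrow> ennreal" (infixr \<open>powr\<^sub>e\<close> 80) where
  "x powr\<^sub>e a = (if x = \<infinity> then \<infinity> else ennreal (enn2real x powr a))"

text \<open>The norm takes values in \<open>[0, \<infinity>]\<close>; the sum over the (possibly uncountable) dual always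
  makes sense there.\<close>

definition lsch_norm ::
  "('g, 'm) monoid_scheme \<Rightarrow> 'g topology \<Rightarrow>
   (('g \<Rightarrow> complex mat) set \<Rightarrow> ('g \<Rightarrow> complex mat)) \<Rightarrow> real \<Rightarrow> 'g dual_map \<Rightarrow> ennreal" where
  "lsch_norm G T \<rho> p H =
     (\<Sum>\<^sub>\<infinity>c\<in>unitary_dual G T.
        of_nat (rep_dim G (\<rho> c)) * ennreal (schatten_norm p (H c) powr p)) powr\<^sub>e (1 / p)"

definition lsch ::
  "('g, 'm) monoid_scheme \<Rightarrow> 'g topology \<Rightarrow>
   (('g \<Rightarrow> complex mat) set \<Rightarrow> ('g \<Rightarrow> complex mat)) \<Rightarrow> real \<Rightarrow> 'g dual_map set" where
  "lsch G T \<rho> p = {H \<in> dual_maps G T \<rho>. lsch_norm G T \<rho> p H < \<infinity>}"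

end

theory Submission
  imports Defs "HOL-Complex_Analysis.Conformal_Mappings"
begin

text \<open>
  For a single matrix block the two inequalities are the Clarkson--McCarthy inequalities for the
  Schatten class \<open>S\<^sup>p\<close>, and both come from one bilinear estimate. Write
  \<open>\<langle>X, A\<rangle> = \<Sum>\<^sub>i\<^sub>j X\<^sub>i\<^sub>j A\<^sub>i\<^sub>j\<close>. For \<open>1 < p \<le> 2\<close> and \<open>1/p + 1/q = 1\<close>,

    \<open>|\<langle>X, A + B\<rangle> + \<langle>Y, A - B\<rangle>| \<le> 2\<^bsup>1/q\<^esup> (\<parallel>A\<parallel>\<^sub>p\<^sup>p + \<parallel>B\<parallel>\<^sub>p\<^sup>p)\<^bsup>1/p\<^esup> (\<parallel>X\<parallel>\<^sub>q\<^sup>p + \<parallel>Y\<parallel>\<^sub>q\<^sup>p)\<^bsup>1/p\<^esup>\<close>   (\<open>bilinear_clarkson\<close>).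

  Choosing \<open>X\<close>, \<open>Y\<close> dual to \<open>A + B\<close>, \<open>A - B\<close> turns it into the inequality for \<open>S\<^sup>p\<close>, \<open>p \<le> 2\<close>; since
  the left-hand side is also \<open>\<langle>A, X + Y\<rangle> + \<langle>B, X - Y\<rangle>\<close>, choosing \<open>A\<close>, \<open>B\<close> dual to \<open>X + Y\<close>,
  \<open>X - Y\<close> turns it into the inequality for \<open>S\<^sup>q\<close>, \<open>q \<ge> 2\<close>.

  The bilinear estimate is proved by complex interpolation. With singular value decompositions of
  the four matrices, replace every singular value by a power of itself whose exponent is affine in
  a complex variable \<open>z\<close>. The pairing becomes a bounded entire function on the strip
  \<open>0 \<le> Re z \<le> 1\<close>. On \<open>Re z = 0\<close> it is estimated by the duality of the trace norm and the operator
  norm (\<open>pairing_dyad_sum_le\<close>), on \<open>Re z = 1\<close> by the Cauchy--Schwarz inequality and the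
  parallelogram law for the Hilbert--Schmidt norm (\<open>pairing_add_diff_le\<close>); the original matrices
  sit at \<open>z = 2/q\<close>, and the three lines theorem interpolates.

  A singular value decomposition of \<open>A\<close> is found by maximizing \<open>|A x|\<close> over unit vectors again and
  again, each time orthogonally to the vectors already found; the maximizers have orthogonal
  images. It diagonalizes \<open>A\<^sup>* A\<close>, and as the functional calculus of a Hermitian matrix does not
  depend on the diagonalization, the Schatten norm is the \<open>\<ell>\<^sup>p\<close> norm of the singular values.

  Finally the blocks are added up with their weights \<open>dim \<xi>\<close>. For \<open>p \<le> 2\<close> the estimates per block
  combine by Minkowski's inequality in the plane with exponent \<open>q/p \<ge> 1\<close>, for \<open>p \<ge> 2\<close> by
  Minkowski's inequality in a weighted \<open>\<ell>\<^bsup>p/q\<^esup>\<close>. This is done over finite sets of blocks, and the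
  sum over the whole dual is the limit.
\<close>

section \<open>Hadamard's three lines theorem\<close>

text \<open>Multiplying \<open>f\<close> by \<open>M0\<^bsup>z - 1\<^esup> M1\<^bsup>-z\<^esup>\<close> normalizes both boundary bounds to \<open>1\<close>. An additional Gaussian
  factor \<open>exp (\<epsilon> (z\<^sup>2 - 1))\<close> has modulus at most \<open>1\<close> on the strip and forces decay at its ends, so that
  the maximum principle on a large rectangle applies; then \<open>\<epsilon>\<close> tends to \<open>0\<close>.\<close>

lemma three_lines:
  fixes f :: "complex \<Rightarrow> complex" and \<theta> M0 M1 B :: real
  assumes holo: "f holomorphic_on {z. 0 < Re z \<and> Re z < 1}"
    and cont: "continuous_on {z. 0 \<le> Re z \<and> Re z \<le> 1} f"
    and bdd: "\<And>z. 0 \<le> Re z \<Longrightarrow> Re z \<le> 1 \<Longrightarrow> norm (f z) \<le> B"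
    and M0: "M0 > 0" "\<And>z. Re z = 0 \<Longrightarrow> norm (f z) \<le> M0"
    and M1: "M1 > 0" "\<And>z. Re z = 1 \<Longrightarrow> norm (f z) \<le> M1"
    and \<theta>: "0 \<le> \<theta>" "\<theta> \<le> 1"
  shows "norm (f (of_real \<theta>)) \<le> M0 powr (1 - \<theta>) * M1 powr \<theta>"
proof -
  define w where "w = (\<lambda>z::complex. (z - 1) * of_real (ln M0) - z * of_real (ln M1))"
  have Re_w: "Re (w z) = (Re z - 1) * ln M0 - Re z * ln M1" for z
    by (simp add: w_def)
  define C where "C = exp (\<bar>ln M0\<bar> + \<bar>ln M1\<bar>)"
  have w_le: "exp (Re (w z)) \<le> C" if "0 \<le> Re z" "Re z \<le> 1" for z
  proof -
    have "\<bar>(Re z - 1) * ln M0\<bar> \<le> 1 * \<bar>ln M0\<bar>" "\<bar>Re z * ln M1\<bar> \<le> 1 * \<bar>ln M1\<bar>"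
      unfolding abs_mult using that by (intro mult_right_mono; simp)+
    then show ?thesis unfolding C_def Re_w by simp
  qed
  have B: "B \<ge> 0" using bdd[of 0] norm_ge_zero[of "f 0"] by (metis order_trans zero_le_one zero_complex.simps(1) order_refl)
  have key: "norm (f (of_real \<theta>)) * exp (Re (w (of_real \<theta>))) \<le> exp (\<epsilon> * (1 - \<theta>\<^sup>2))" if "\<epsilon> > 0" for \<epsilon> :: real
  proof -
    define g where "g = (\<lambda>z. f z * exp (w z) * exp (of_real \<epsilon> * (z\<^sup>2 - 1)))"
    have norm_g: "norm (g z) = norm (f z) * exp (Re (w z)) * exp (\<epsilon> * ((Re z)\<^sup>2 - (Im z)\<^sup>2 - 1))" for z
      by (simp add: g_def norm_mult power2_eq_square)
    \<comment> \<open>At this height the Gaussian factor outweighs the bound \<open>B * C\<close> of the rest.\<close>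
    define R where "R = sqrt (\<bar>ln (B * C + 1)\<bar> / \<epsilon>)"
    have R0: "R \<ge> 0" unfolding R_def using that by simp
    have "R\<^sup>2 = \<bar>ln (B * C + 1)\<bar> / \<epsilon>" unfolding R_def using that by simp
    then have R: "\<epsilon> * R\<^sup>2 \<ge> ln (B * C + 1)" using that by simp
    define S where "S = cbox (Complex 0 (-R)) (Complex 1 R)"
    have S: "z \<in> S \<longleftrightarrow> 0 \<le> Re z \<and> Re z \<le> 1 \<and> \<bar>Im z\<bar> \<le> R" for z
      by (auto simp: S_def in_cbox_complex_iff)
    have intS: "z \<in> interior S \<longleftrightarrow> 0 < Re z \<and> Re z < 1 \<and> \<bar>Im z\<bar> < R" for z
      by (auto simp: S_def interior_cbox in_box_complex_iff)
    have "norm (g (of_real \<theta>)) \<le> 1"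
    proof (rule maximum_modulus_frontier[where S = S and f = g])
      show "g holomorphic_on interior S"
        unfolding g_def w_def
        by (intro holomorphic_intros holomorphic_on_subset[OF holo] subsetI) (simp add: intS)
      have "closure S = S" unfolding S_def by simp
      then show "continuous_on (closure S) g"
        unfolding g_def w_def
        by (intro continuous_intros continuous_on_subset[OF cont] subsetI) (simp add: S)
      show "bounded S" unfolding S_def by simp
      show "of_real \<theta> \<in> S" using \<theta> R0 by (simp add: S)
      fix z assume "z \<in> frontier S"
      then have z: "z \<in> S" "z \<notin> interior S" using \<open>closure S = S\<close> by (auto simp: frontier_def)
      then have re: "0 \<le> Re z" "Re z \<le> 1" by (auto simp: S)
      then have re2: "(Re z)\<^sup>2 \<le> 1" by (simp add: power_le_one)
      have "(Re z)\<^sup>2 - (Im z)\<^sup>2 - 1 \<le> 0" using re2 zero_le_power2[of "Im z"] by linarith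
      then have gauss: "exp (\<epsilon> * ((Re z)\<^sup>2 - (Im z)\<^sup>2 - 1)) \<le> 1"
        using that by (simp add: mult_le_0_iff)
      consider "Re z = 0" | "Re z = 1" | "\<bar>Im z\<bar> = R"
        using z by (force simp: S intS)
      then show "norm (g z) \<le> 1"
      proof cases
        case 1
        have "norm (f z) * exp (Re (w z)) \<le> M0 * exp (Re (w z))" using M0(2)[OF 1] by simp
        also have "\<dots> = 1" using M0(1) 1 by (simp add: Re_w exp_minus)
        finally show ?thesis unfolding norm_g by (rule mult_le_one[OF _ _ gauss]) simp
      next
        case 2
        have "norm (f z) * exp (Re (w z)) \<le> M1 * exp (Re (w z))" using M1(2)[OF 2] by simp
        also have "\<dots> = 1" using M1(1) 2 by (simp add: Re_w exp_minus)
        finally show ?thesis unfolding norm_g by (rule mult_le_one[OF _ _ gauss]) simp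
      next
        case 3
        then have "(Im z)\<^sup>2 = R\<^sup>2" by (metis power2_abs)
        moreover have "\<epsilon> * ((Re z)\<^sup>2 - 1) \<le> 0" using re2 that by (simp add: mult_le_0_iff)
        ultimately have "\<epsilon> * ((Re z)\<^sup>2 - (Im z)\<^sup>2 - 1) \<le> - ln (B * C + 1)"
          using R by (simp add: algebra_simps)
        moreover have pos: "B * C + 1 > 0" using B by (simp add: C_def add_nonneg_pos)
        ultimately have e: "exp (\<epsilon> * ((Re z)\<^sup>2 - (Im z)\<^sup>2 - 1)) \<le> 1 / (B * C + 1)"
          by (metis exp_le_cancel_iff exp_ln exp_minus inverse_eq_divide)
        have "norm (g z) \<le> B * C * (1 / (B * C + 1))" unfolding norm_g
          using bdd[OF re] w_le[OF re] B e by (intro mult_mono) (auto simp: C_def)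
        also have "\<dots> \<le> 1" using pos by simp
        finally show ?thesis .
      qed
    qed
    then have "norm (f (of_real \<theta>)) * exp (Re (w (of_real \<theta>))) * exp (\<epsilon> * (\<theta>\<^sup>2 - 1)) \<le> 1"
      by (simp add: norm_g)
    then have "norm (f (of_real \<theta>)) * exp (Re (w (of_real \<theta>))) * exp (\<epsilon> * (\<theta>\<^sup>2 - 1)) * exp (\<epsilon> * (1 - \<theta>\<^sup>2))
      \<le> 1 * exp (\<epsilon> * (1 - \<theta>\<^sup>2))" by (intro mult_right_mono) auto
    moreover have "exp (\<epsilon> * (\<theta>\<^sup>2 - 1)) * exp (\<epsilon> * (1 - \<theta>\<^sup>2)) = 1"
      by (simp flip: exp_add distrib_left)
    ultimately show ?thesis by (metis mult.assoc mult.right_neutral mult_1)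
  qed
  have lim: "((\<lambda>\<epsilon>. exp (\<epsilon> * (1 - \<theta>\<^sup>2))) \<longlongrightarrow> exp (0 * (1 - \<theta>\<^sup>2))) (at_right 0)"
    by (intro tendsto_intros)
  have "norm (f (of_real \<theta>)) * exp (Re (w (of_real \<theta>))) \<le> exp (0 * (1 - \<theta>\<^sup>2))"
    by (rule tendsto_lowerbound[OF lim]) (auto simp: eventually_at_right_less key intro: eventually_mono[OF eventually_at_right_less[of 0]])
  then have "norm (f (of_real \<theta>)) * exp (Re (w (of_real \<theta>))) * exp (- Re (w (of_real \<theta>))) \<le> 1 * exp (- Re (w (of_real \<theta>)))"
    by (intro mult_right_mono) auto
  then have "norm (f (of_real \<theta>)) \<le> exp (- Re (w (of_real \<theta>)))"
    by (simp add: mult.assoc flip: exp_add)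
  also have "\<dots> = M0 powr (1 - \<theta>) * M1 powr \<theta>"
    using M0(1) M1(1) by (simp add: Re_w powr_def algebra_simps flip: exp_add)
  finally show ?thesis .
qed

section \<open>Orthogonal families and sums of dyads\<close>

definition herm_inner :: "nat \<Rightarrow> (nat \<Rightarrow> complex) \<Rightarrow> (nat \<Rightarrow> complex) \<Rightarrow> complex" where
  "herm_inner n x y = (\<Sum>i<n. x i * cnj (y i))"

definition normsq :: "nat \<Rightarrow> (nat \<Rightarrow> complex) \<Rightarrow> real" where
  "normsq n x = (\<Sum>i<n. (cmod (x i))\<^sup>2)"

text \<open>Norms below \<open>1\<close> are allowed, zero in particular: in a singular value decomposition the left
  vectors belonging to vanishing singular values may then be taken to be zero, and no completion to
  a basis is needed.\<close>

definition orthofam :: "nat \<Rightarrow> nat \<Rightarrow> (nat \<Rightarrow> nat \<Rightarrow> complex) \<Rightarrow> bool" where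
  "orthofam n m e \<longleftrightarrow> (\<forall>k<m. \<forall>l<m. k \<noteq> l \<longrightarrow> herm_inner n (e k) (e l) = 0) \<and> (\<forall>k<m. normsq n (e k) \<le> 1)"

lemma herm_inner_self: "herm_inner n x x = of_real (normsq n x)"
  unfolding herm_inner_def normsq_def by (simp add: complex_norm_square del: of_real_power)

lemma herm_inner_commute: "herm_inner n y x = cnj (herm_inner n x y)"
  unfolding herm_inner_def by (simp add: mult.commute)

lemma cmod_herm_inner_commute: "cmod (herm_inner n x y) = cmod (herm_inner n y x)"
  by (subst herm_inner_commute) simp

lemma normsq_nonneg [simp]: "normsq n x \<ge> 0"
  unfolding normsq_def by (intro sum_nonneg) auto

lemma herm_inner_sum_right: "herm_inner n x (\<lambda>i. \<Sum>k<m. c k * e k i) = (\<Sum>k<m. cnj (c k) * herm_inner n x (e k))"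
  unfolding herm_inner_def by (simp add: sum_distrib_left, subst sum.swap) (simp add: mult_ac)

lemma herm_inner_sum_left: "herm_inner n (\<lambda>i. \<Sum>k<m. c k * e k i) x = (\<Sum>k<m. c k * herm_inner n (e k) x)"
  by (subst (1 2) herm_inner_commute) (simp add: herm_inner_sum_right)

lemma normsq_diff: "normsq n (\<lambda>i. x i - y i) = normsq n x - 2 * Re (herm_inner n x y) + normsq n y"
proof -
  have "(cmod (a - b))\<^sup>2 = (cmod a)\<^sup>2 - 2 * Re (a * cnj b) + (cmod b)\<^sup>2" for a b
    unfolding cmod_power2 by (simp add: algebra_simps power2_eq_square)
  then show ?thesis
    unfolding herm_inner_def normsq_def by (simp add: sum.distrib sum_subtractf sum_distrib_left)
qed

lemma normsq_orthofam_sum: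
  assumes "orthofam n m e"
  shows "normsq n (\<lambda>i. \<Sum>k<m. c k * e k i) = (\<Sum>k<m. (cmod (c k))\<^sup>2 * normsq n (e k))"
proof -
  have "of_real (normsq n (\<lambda>i. \<Sum>k<m. c k * e k i)) = (\<Sum>k<m. c k * (\<Sum>l<m. cnj (c l) * herm_inner n (e k) (e l)))"
    unfolding herm_inner_self[symmetric] herm_inner_sum_left by (simp add: herm_inner_sum_right)
  also have "\<dots> = (\<Sum>k<m. c k * (\<Sum>l<m. if l = k then cnj (c k) * herm_inner n (e k) (e k) else 0))"
    using assms unfolding orthofam_def by (intro sum.cong arg_cong2[of _ _ _ _ "(*)"] refl) auto
  also have "\<dots> = of_real (\<Sum>k<m. (cmod (c k))\<^sup>2 * normsq n (e k))"
    by (simp add: herm_inner_self complex_norm_square mult_ac del: of_real_power)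
  finally show ?thesis using of_real_eq_iff by blast
qed

lemma normsq_orthofam_sum_le:
  assumes "orthofam n m e"
  shows "normsq n (\<lambda>i. \<Sum>k<m. c k * e k i) \<le> (\<Sum>k<m. (cmod (c k))\<^sup>2)"
  unfolding normsq_orthofam_sum[OF assms] using assms
  by (intro sum_mono mult_left_le) (auto simp: orthofam_def)

text \<open>For norms at most \<open>1\<close> Bessel's inequality still follows from \<open>0 \<le> |x - y|\<^sup>2\<close> with
  \<open>y = \<Sum>\<^sub>k \<langle>x, e\<^sub>k\<rangle> e\<^sub>k\<close>, because \<open>\<langle>x, y\<rangle> = \<Sum>\<^sub>k |\<langle>x, e\<^sub>k\<rangle>|\<^sup>2\<close> and \<open>|y|\<^sup>2\<close> is at most this sum.\<close>

lemma bessel: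
  assumes "orthofam n m e"
  shows "(\<Sum>k<m. (cmod (herm_inner n x (e k)))\<^sup>2) \<le> normsq n x"
proof -
  let ?y = "\<lambda>i. \<Sum>k<m. herm_inner n x (e k) * e k i"
  have "herm_inner n x ?y = of_real (\<Sum>k<m. (cmod (herm_inner n x (e k)))\<^sup>2)"
    unfolding herm_inner_sum_right by (simp add: complex_norm_square mult_ac del: of_real_power)
  then have "0 \<le> normsq n x - 2 * (\<Sum>k<m. (cmod (herm_inner n x (e k)))\<^sup>2) + normsq n ?y"
    using normsq_diff[of n x ?y] normsq_nonneg[of n "\<lambda>i. x i - ?y i"] by simp
  with normsq_orthofam_sum_le[OF assms, of "\<lambda>k. herm_inner n x (e k)"] show ?thesis by simp
qed

text \<open>The entries of \<open>\<Sum>\<^sub>k t\<^sub>k u\<^sub>k v\<^sub>k\<^sup>*\<close>. Complex coefficients are needed because the singular values will be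
  raised to complex powers.\<close>

definition dyad_sum :: "nat \<Rightarrow> (nat \<Rightarrow> complex) \<Rightarrow> (nat \<Rightarrow> nat \<Rightarrow> complex) \<Rightarrow> (nat \<Rightarrow> nat \<Rightarrow> complex)
    \<Rightarrow> nat \<Rightarrow> nat \<Rightarrow> complex" where
  "dyad_sum n t u v i j = (\<Sum>k<n. t k * u k i * cnj (v k j))"

text \<open>This is \<open>tr (X\<^sup>T A)\<close>. Being bilinear, and not sesquilinear, it keeps holomorphic dependence on both
  arguments.\<close>

definition pairing :: "nat \<Rightarrow> (nat \<Rightarrow> nat \<Rightarrow> complex) \<Rightarrow> (nat \<Rightarrow> nat \<Rightarrow> complex) \<Rightarrow> complex" where
  "pairing n X A = (\<Sum>i<n. \<Sum>j<n. X i j * A i j)"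

lemma orthofam_cnj: "orthofam n m e \<Longrightarrow> orthofam n m (\<lambda>k i. cnj (e k i))"
proof -
  have "herm_inner n (\<lambda>i. cnj (x i)) (\<lambda>i. cnj (y i)) = cnj (herm_inner n x y)" for x y by (simp add: herm_inner_def)
  then show "orthofam n m e \<Longrightarrow> ?thesis" by (simp add: orthofam_def normsq_def)
qed

text \<open>Row \<open>i\<close> of the matrix is a combination of the conjugates of the \<open>v\<^sub>k\<close> with coefficients
  \<open>t\<^sub>k (u\<^sub>k)\<^sub>i\<close>, and the \<open>u\<^sub>k\<close> have norm at most \<open>1\<close>.\<close>

lemma hilbert_schmidt_dyad_sum_le:
  assumes u: "orthofam n n u" and v: "orthofam n n v"
  shows "(\<Sum>i<n. \<Sum>j<n. (cmod (dyad_sum n t u v i j))\<^sup>2) \<le> (\<Sum>k<n. (cmod (t k))\<^sup>2)"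
proof -
  have "(\<Sum>j<n. (cmod (dyad_sum n t u v i j))\<^sup>2) \<le> (\<Sum>k<n. (cmod (t k * u k i))\<^sup>2)" for i
    using normsq_orthofam_sum_le[OF orthofam_cnj[OF v], of "\<lambda>k. t k * u k i"]
    unfolding normsq_def dyad_sum_def by simp
  then have "(\<Sum>i<n. \<Sum>j<n. (cmod (dyad_sum n t u v i j))\<^sup>2) \<le> (\<Sum>i<n. \<Sum>k<n. (cmod (t k * u k i))\<^sup>2)"
    by (rule sum_mono)
  also have "\<dots> = (\<Sum>k<n. (cmod (t k))\<^sup>2 * normsq n (u k))"
    unfolding normsq_def by (subst sum.swap) (simp add: norm_mult power_mult_distrib sum_distrib_left)
  also have "\<dots> \<le> (\<Sum>k<n. (cmod (t k))\<^sup>2)"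
    using u by (intro sum_mono mult_left_le) (auto simp: orthofam_def)
  finally show ?thesis .
qed

lemma sum_rotate3:
  "(\<Sum>i\<in>A. \<Sum>j\<in>B. \<Sum>k\<in>C. f i j k) = (\<Sum>k\<in>C. \<Sum>i\<in>A. \<Sum>j\<in>B. f i j k)"
proof -
  have "(\<Sum>i\<in>A. \<Sum>j\<in>B. \<Sum>k\<in>C. f i j k) = (\<Sum>i\<in>A. \<Sum>k\<in>C. \<Sum>j\<in>B. f i j k)"
    by (intro sum.cong refl sum.swap)
  also have "\<dots> = (\<Sum>k\<in>C. \<Sum>i\<in>A. \<Sum>j\<in>B. f i j k)" by (rule sum.swap)
  finally show ?thesis .
qed

lemma pairing_dyad_sum_left:
  "pairing n (dyad_sum n t a b) A = (\<Sum>l<n. t l * (\<Sum>i<n. \<Sum>j<n. a l i * cnj (b l j) * A i j))"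
proof -
  have "pairing n (dyad_sum n t a b) A = (\<Sum>i<n. \<Sum>j<n. \<Sum>l<n. t l * (a l i * cnj (b l j) * A i j))"
    unfolding pairing_def dyad_sum_def by (simp add: sum_distrib_right mult.assoc)
  then show ?thesis by (subst (asm) sum_rotate3) (simp add: sum_distrib_left)
qed

lemma pairing_commute: "pairing n X A = pairing n A X"
  unfolding pairing_def by (simp add: mult.commute)

lemma pairing_dyad_sum:
  "pairing n (dyad_sum n t a b) (dyad_sum n s u v) =
    (\<Sum>k<n. s k * (\<Sum>l<n. t l * (herm_inner n (a l) (\<lambda>i. cnj (u k i)) * herm_inner n (\<lambda>j. cnj (b l j)) (v k))))"
proof -
  have "(\<Sum>i<n. \<Sum>j<n. u k i * cnj (v k j) * dyad_sum n t a b i j) =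
      (\<Sum>l<n. t l * (herm_inner n (a l) (\<lambda>i. cnj (u k i)) * herm_inner n (\<lambda>j. cnj (b l j)) (v k)))" for k
  proof -
    have "(\<Sum>i<n. \<Sum>j<n. u k i * cnj (v k j) * dyad_sum n t a b i j) = pairing n (dyad_sum n t a b) (\<lambda>i j. u k i * cnj (v k j))"
      unfolding pairing_def by (simp add: mult.commute)
    also have "\<dots> = (\<Sum>l<n. t l * (\<Sum>i<n. \<Sum>j<n. (a l i * u k i) * (cnj (b l j) * cnj (v k j))))"
      unfolding pairing_dyad_sum_left by (simp add: mult_ac)
    finally show ?thesis unfolding herm_inner_def by (simp add: sum_product)
  qed
  then show ?thesis
    by (simp only: pairing_commute[of n "dyad_sum n t a b" "dyad_sum n s u v"] pairing_dyad_sum_left[of n s u v])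
qed

text \<open>Trace norm against operator norm: each \<open>u\<^sub>k v\<^sub>k\<^sup>*\<close> pairs with the other matrix to a number of modulus
  at most \<open>\<tau>\<close>, by the Cauchy--Schwarz inequality and Bessel's inequality for both of its families.\<close>

lemma pairing_dyad_sum_le:
  assumes "orthofam n n u" "orthofam n n v" "orthofam n n a" "orthofam n n b"
    and t: "\<And>l. l < n \<Longrightarrow> cmod (t l) \<le> \<tau>" and "\<tau> \<ge> 0"
  shows "cmod (pairing n (dyad_sum n t a b) (dyad_sum n s u v)) \<le> \<tau> * (\<Sum>k<n. cmod (s k))"
proof -
  have *: "cmod (\<Sum>l<n. t l * (herm_inner n (a l) (\<lambda>i. cnj (u k i)) * herm_inner n (\<lambda>j. cnj (b l j)) (v k))) \<le> \<tau>" if k: "k < n" for k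
  proof -
    let ?f = "\<lambda>l. cmod (herm_inner n (a l) (\<lambda>i. cnj (u k i)))" and ?g = "\<lambda>l. cmod (herm_inner n (\<lambda>j. cnj (b l j)) (v k))"
    have f: "(\<Sum>l<n. (?f l)\<^sup>2) \<le> 1"
      using bessel[OF assms(3), of "\<lambda>i. cnj (u k i)"] assms(1) k
      by (simp add: cmod_herm_inner_commute[of n "a _"] orthofam_def normsq_def order_trans)
    have g: "(\<Sum>l<n. (?g l)\<^sup>2) \<le> 1"
      using bessel[OF orthofam_cnj[OF assms(4)], of "v k"] assms(2) k
      by (simp add: cmod_herm_inner_commute[of n "\<lambda>j. cnj (b _ j)"] orthofam_def order_trans)
    have "(\<Sum>l<n. ?f l * ?g l)\<^sup>2 \<le> 1\<^sup>2"
      using order_trans[OF Cauchy_Schwarz_ineq_sum[of ?f ?g "{..<n}"] mult_mono[OF f g]]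
      by (simp add: sum_nonneg)
    then have fg: "(\<Sum>l<n. ?f l * ?g l) \<le> 1" by (rule power2_le_imp_le) simp
    have "cmod (\<Sum>l<n. t l * (herm_inner n (a l) (\<lambda>i. cnj (u k i)) * herm_inner n (\<lambda>j. cnj (b l j)) (v k)))
       \<le> (\<Sum>l<n. \<tau> * (?f l * ?g l))"
      by (intro sum_norm_le) (auto simp: norm_mult intro!: mult_right_mono t)
    also have "\<dots> \<le> \<tau> * 1" unfolding sum_distrib_left[symmetric] by (intro mult_left_mono fg assms)
    finally show ?thesis by simp
  qed
  have "cmod (pairing n (dyad_sum n t a b) (dyad_sum n s u v)) \<le> (\<Sum>k<n. cmod (s k) * \<tau>)"
    unfolding pairing_dyad_sum
    by (intro sum_norm_le) (auto simp: norm_mult intro!: mult_left_mono *)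
  then show ?thesis by (simp add: sum_distrib_left mult.commute)
qed

text \<open>The Cauchy--Schwarz inequality on pairs of matrices; the factor \<open>2\<close> is the parallelogram law
  \<open>|a + b|\<^sup>2 + |a - b|\<^sup>2 = 2 |a|\<^sup>2 + 2 |b|\<^sup>2\<close>.\<close>

lemma pairing_add_diff_le:
  "(cmod (pairing n X (\<lambda>i j. A i j + B i j) + pairing n Y (\<lambda>i j. A i j - B i j)))\<^sup>2
   \<le> 2 * ((\<Sum>i<n. \<Sum>j<n. (cmod (X i j))\<^sup>2) + (\<Sum>i<n. \<Sum>j<n. (cmod (Y i j))\<^sup>2)) *
     ((\<Sum>i<n. \<Sum>j<n. (cmod (A i j))\<^sup>2) + (\<Sum>i<n. \<Sum>j<n. (cmod (B i j))\<^sup>2))"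
proof -
  \<comment> \<open>The index set of pairs of matrices: \<open>True\<close> marks the first component.\<close>
  let ?I = "(UNIV :: bool set) \<times> {..<n} \<times> {..<n}"
  define f where "f = (\<lambda>(h, i, j). cmod ((if h then X else Y) i j))"
  define g where "g = (\<lambda>(h, i, j). cmod (if h then A i j + B i j else A i j - B i j))"
  have split: "(\<Sum>x\<in>?I. F x) = (\<Sum>i<n. \<Sum>j<n. F (True, i, j)) + (\<Sum>i<n. \<Sum>j<n. F (False, i, j))"
    for F :: "_ \<Rightarrow> real"
    by (simp add: sum.cartesian_product' UNIV_bool sum.cartesian_product flip: sum.cartesian_product)
  have "cmod (pairing n X (\<lambda>i j. A i j + B i j) + pairing n Y (\<lambda>i j. A i j - B i j)) \<le> (\<Sum>x\<in>?I. f x * g x)"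
    unfolding split pairing_def
    by (intro norm_triangle_le add_mono sum_norm_le) (auto simp: f_def g_def norm_mult)
  then have "(cmod (pairing n X (\<lambda>i j. A i j + B i j) + pairing n Y (\<lambda>i j. A i j - B i j)))\<^sup>2 \<le> (\<Sum>x\<in>?I. f x * g x)\<^sup>2"
    by (intro power_mono) auto
  also have "\<dots> \<le> (\<Sum>x\<in>?I. (f x)\<^sup>2) * (\<Sum>x\<in>?I. (g x)\<^sup>2)" by (rule Cauchy_Schwarz_ineq_sum)
  also have "(\<Sum>x\<in>?I. (g x)\<^sup>2) = 2 * ((\<Sum>i<n. \<Sum>j<n. (cmod (A i j))\<^sup>2) + (\<Sum>i<n. \<Sum>j<n. (cmod (B i j))\<^sup>2))"
  proof -
    have "(cmod (a + b))\<^sup>2 + (cmod (a - b))\<^sup>2 = 2 * (cmod a)\<^sup>2 + 2 * (cmod b)\<^sup>2" for a b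
      unfolding cmod_power2 by (simp add: algebra_simps power2_eq_square)
    then have "(\<Sum>x\<in>?I. (g x)\<^sup>2) = (\<Sum>i<n. \<Sum>j<n. 2 * (cmod (A i j))\<^sup>2 + 2 * (cmod (B i j))\<^sup>2)"
      unfolding split g_def by (simp only: prod.case if_True if_False sum.distrib[symmetric])
    then show ?thesis by (simp add: sum.distrib sum_distrib_left)
  qed
  also have "(\<Sum>x\<in>?I. (f x)\<^sup>2) = (\<Sum>i<n. \<Sum>j<n. (cmod (X i j))\<^sup>2) + (\<Sum>i<n. \<Sum>j<n. (cmod (Y i j))\<^sup>2)"
    unfolding split f_def by simp
  finally show ?thesis by (simp only: mult_ac)
qed

section \<open>Interpolation\<close>

lemma bounded_mult_comp:
  fixes f g :: "'a \<Rightarrow> complex"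
  assumes "bounded (f ` S)" "bounded (g ` S)"
  shows "bounded ((\<lambda>x. f x * g x) ` S)"
proof -
  obtain a b where "\<forall>x\<in>S. norm (f x) \<le> a" "\<forall>x\<in>S. norm (g x) \<le> b"
    using assms by (auto simp: bounded_iff)
  then have "\<forall>x\<in>S. norm (f x * g x) \<le> a * b"
    by (auto simp: norm_mult intro!: mult_mono intro: order_trans[OF norm_ge_zero])
  then show ?thesis by (auto simp: bounded_iff)
qed

lemma bounded_sum_comp:
  fixes f :: "'i \<Rightarrow> 'a \<Rightarrow> complex"
  assumes "\<And>i. i \<in> I \<Longrightarrow> bounded (f i ` S)"
  shows "bounded ((\<lambda>x. \<Sum>i\<in>I. f i x) ` S)"
  using assms
proof (induction I rule: infinite_finite_induct)
  case (insert i I)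
  then show ?case using bounded_plus_comp[of "f i" S "\<lambda>x. \<Sum>i\<in>I. f i x"] by simp
qed (auto simp: bounded_iff)

lemma bounded_const_comp: "bounded ((\<lambda>x. c :: complex) ` S)"
  by (auto simp: bounded_iff)

lemma cmod_real_powr: "a \<ge> 0 \<Longrightarrow> cmod (of_real a powr w) = a powr Re w"
  by (subst norm_powr_real_powr) auto

text \<open>The modulus depends on \<open>Re z\<close> only and is monotone in it, hence at most the larger of the two
  boundary values.\<close>

lemma bounded_powr_strip:
  assumes "a \<ge> 0"
  shows "bounded ((\<lambda>z. complex_of_real a powr (of_real c + of_real d * z)) ` {z. 0 \<le> Re z \<and> Re z \<le> 1})"
proof -
  have "a powr (c + d * t) \<le> a powr c + a powr (c + d)" if t: "0 \<le> t" "t \<le> 1" for t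
  proof -
    have mm: "min c (c + d) \<le> c + d * t" "c + d * t \<le> max c (c + d)"
      using t by (auto simp: min_def max_def mult_left_le mult_le_cancel_left1 mult_le_cancel_left2 zero_le_mult_iff mult_le_0_iff)
    have "a powr (c + d * t) \<le> max (a powr c) (a powr (c + d))"
    proof (cases "a \<ge> 1")
      case True
      then have "a powr (c + d * t) \<le> a powr (max c (c + d))" by (intro powr_mono mm)
      then show ?thesis by (auto simp: max_def split: if_splits)
    next
      case False
      then have "a powr (c + d * t) \<le> a powr (min c (c + d))" using assms by (intro powr_mono' mm) auto
      then show ?thesis by (auto simp: max_def min_def split: if_splits)
    qed
    then show ?thesis by (auto simp: max_def add_increasing add_increasing2 split: if_splits)
  qed
  then show ?thesis
    by (auto simp: bounded_iff cmod_real_powr[OF assms] intro!: exI[of _ "a powr c + a powr (c + d)"])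
qed

lemma pairing_add_right: "pairing n X (\<lambda>i j. A i j + B i j) = pairing n X A + pairing n X B"
  by (simp add: pairing_def distrib_left sum.distrib)

lemma pairing_diff_right: "pairing n X (\<lambda>i j. A i j - B i j) = pairing n X A - pairing n X B"
  by (simp add: pairing_def right_diff_distrib sum_subtractf)

lemma dyad_sum_cong: "(\<And>k. k < n \<Longrightarrow> t k = s k) \<Longrightarrow> dyad_sum n t u v = dyad_sum n s u v"
  by (intro ext) (simp add: dyad_sum_def)

text \<open>The interpolation argument. Let \<open>N\<close> and \<open>K\<close> be the two bracketed quantities of the bound. The exponents are
  the affine functions of \<open>z\<close> for which the matrices at \<open>z = 2/q\<close> are the given ones, the coefficients
  \<open>\<alpha>\<close>, \<open>\<beta>\<close> have \<open>\<ell>\<^sup>1\<close> norm \<open>N\<close> on \<open>Re z = 0\<close> and squared \<open>\<ell>\<^sup>2\<close> norm \<open>N\<close> on \<open>Re z = 1\<close>, and the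
  coefficients \<open>\<xi>\<close>, \<open>\<eta>\<close> have suprema adding up to at most \<open>K\<close> on the first line and squared \<open>\<ell>\<^sup>2\<close> norm
  \<open>K\<close> on the second. The boundary bounds are then \<open>N K\<close> and \<open>(2 N K)\<^bsup>1/2\<^esup>\<close>.\<close>

lemma bilinear_clarkson:
  fixes \<alpha> \<beta> \<xi> \<eta> :: "nat \<Rightarrow> real" and p q x y :: real
  assumes p: "1 < p" "p \<le> 2" and pq: "1 / p + 1 / q = 1"
    and fam: "orthofam n n u" "orthofam n n v" "orthofam n n u'" "orthofam n n v'"
       "orthofam n n a" "orthofam n n b" "orthofam n n a'" "orthofam n n b'"
    and nonneg: "\<And>k. \<alpha> k \<ge> 0" "\<And>k. \<beta> k \<ge> 0" "\<And>k. \<xi> k \<ge> 0" "\<And>k. \<eta> k \<ge> 0" "x \<ge> 0" "y \<ge> 0"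
    and x: "x powr q = (\<Sum>k<n. \<xi> k powr q)" and y: "y powr q = (\<Sum>k<n. \<eta> k powr q)"
  defines "A \<equiv> dyad_sum n (\<lambda>k. of_real (\<alpha> k)) u v" and "B \<equiv> dyad_sum n (\<lambda>k. of_real (\<beta> k)) u' v'"
    and "X \<equiv> dyad_sum n (\<lambda>k. of_real (\<xi> k)) a b" and "Y \<equiv> dyad_sum n (\<lambda>k. of_real (\<eta> k)) a' b'"
  shows "cmod (pairing n X (\<lambda>i j. A i j + B i j) + pairing n Y (\<lambda>i j. A i j - B i j))
    \<le> 2 powr (1 / q) * ((\<Sum>k<n. \<alpha> k powr p) + (\<Sum>k<n. \<beta> k powr p)) powr (1 / p)
       * (x powr p + y powr p) powr (1 / p)"
proof -
  define N where "N = (\<Sum>k<n. \<alpha> k powr p) + (\<Sum>k<n. \<beta> k powr p)"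
  define K where "K = x powr p + y powr p"
  have N0: "N \<ge> 0" and K0: "K \<ge> 0" unfolding N_def K_def by (auto intro!: add_nonneg_nonneg sum_nonneg)
  have q0: "q > 0" using p pq by (smt (verit) divide_less_eq_1_pos zero_less_divide_1_iff)
  have q2: "q \<ge> 2"
  proof -
    have "1 / 2 \<le> 1 / p" using p by (intro frac_le) auto
    then have "1 / q \<le> 1 / 2" using pq by linarith
    then show ?thesis using q0 by (simp add: field_simps)
  qed
  have pq': "p - p / q = 1" using pq p q0 by (simp add: field_simps)
  \<comment> \<open>The point with \<open>1 / p = (1 - \<theta>) / 1 + \<theta> / 2\<close>.\<close>
  define \<theta> where "\<theta> = 2 / q"
  have \<theta>: "0 \<le> \<theta>" "\<theta> \<le> 1" using q2 by (auto simp: \<theta>_def)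
  define e where "e = (\<lambda>z. complex_of_real p + of_real (- p / 2) * z)"
  define s where "s = (\<lambda>z. complex_of_real p + of_real (- (p + q) / 2) * z)"
  define r where "r = (\<lambda>z. complex_of_real 0 + of_real (q / 2) * z)"
  have Re_e: "Re (e z) = p - p / 2 * Re z" and Re_s: "Re (s z) = p - (p + q) / 2 * Re z"
    and Re_r: "Re (r z) = q / 2 * Re z" for z
    by (auto simp: e_def s_def r_def field_simps)
  define At where "At = (\<lambda>z k. complex_of_real (\<alpha> k) powr e z)"
  define Bt where "Bt = (\<lambda>z k. complex_of_real (\<beta> k) powr e z)"
  define Xt where "Xt = (\<lambda>z k. complex_of_real x powr s z * complex_of_real (\<xi> k) powr r z)"
  define Yt where "Yt = (\<lambda>z k. complex_of_real y powr s z * complex_of_real (\<eta> k) powr r z)"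
  have norms: "cmod (At z k) = \<alpha> k powr (p - p / 2 * Re z)"
     "cmod (Bt z k) = \<beta> k powr (p - p / 2 * Re z)"
     "cmod (Xt z k) = x powr (p - (p + q) / 2 * Re z) * \<xi> k powr (q / 2 * Re z)"
     "cmod (Yt z k) = y powr (p - (p + q) / 2 * Re z) * \<eta> k powr (q / 2 * Re z)" for z k
    by (auto simp: At_def Bt_def Xt_def Yt_def norm_mult cmod_real_powr nonneg Re_e Re_s Re_r)
  define Az where "Az = (\<lambda>z. dyad_sum n (At z) u v)"
  define Bz where "Bz = (\<lambda>z. dyad_sum n (Bt z) u' v')"
  define Xz where "Xz = (\<lambda>z. dyad_sum n (Xt z) a b)"
  define Yz where "Yz = (\<lambda>z. dyad_sum n (Yt z) a' b')"
  define F where "F = (\<lambda>z. pairing n (Xz z) (\<lambda>i j. Az z i j + Bz z i j) + pairing n (Yz z) (\<lambda>i j. Az z i j - Bz z i j))"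
  note unfolds = F_def Az_def Bz_def Xz_def Yz_def At_def Bt_def Xt_def Yt_def e_def s_def r_def dyad_sum_def pairing_def
  have holo: "F holomorphic_on UNIV"
    unfolding unfolds by (intro holomorphic_intros)
  have bdd: "bounded (F ` {z. 0 \<le> Re z \<and> Re z \<le> 1})"
    unfolding unfolds
    by (intro bounded_plus_comp bounded_minus_comp bounded_mult_comp bounded_sum_comp bounded_const_comp
        bounded_powr_strip nonneg)
  then obtain M where M: "\<And>z. 0 \<le> Re z \<Longrightarrow> Re z \<le> 1 \<Longrightarrow> cmod (F z) \<le> M"
    by (auto simp: bounded_iff)
  have line0: "cmod (F z) \<le> N * K" if z: "Re z = 0" for z
  proof -
    have "x powr p * \<xi> k powr 0 \<le> x powr p" "y powr p * \<eta> k powr 0 \<le> y powr p" for k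
      by auto
    then have t: "cmod (Xt z k) \<le> x powr p" "cmod (Yt z k) \<le> y powr p" for k
      unfolding norms z by auto
    have sums: "(\<Sum>k<n. cmod (At z k)) = (\<Sum>k<n. \<alpha> k powr p)" "(\<Sum>k<n. cmod (Bt z k)) = (\<Sum>k<n. \<beta> k powr p)"
      unfolding norms z by auto
    have "cmod (F z) \<le> (cmod (pairing n (Xz z) (Az z)) + cmod (pairing n (Xz z) (Bz z)))
       + (cmod (pairing n (Yz z) (Az z)) + cmod (pairing n (Yz z) (Bz z)))"
      unfolding F_def pairing_add_right pairing_diff_right
      by (intro norm_triangle_le add_mono norm_triangle_ineq norm_triangle_ineq4)
    also have "\<dots> \<le> (x powr p * (\<Sum>k<n. \<alpha> k powr p) + x powr p * (\<Sum>k<n. \<beta> k powr p))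
       + (y powr p * (\<Sum>k<n. \<alpha> k powr p) + y powr p * (\<Sum>k<n. \<beta> k powr p))"
      unfolding Xz_def Yz_def Az_def Bz_def sums[symmetric]
      by (intro add_mono pairing_dyad_sum_le fam t) auto
    also have "\<dots> = N * K" by (simp add: N_def K_def algebra_simps)
    finally show ?thesis .
  qed
  have line1: "cmod (F z) \<le> sqrt (2 * (N * K))" if z: "Re z = 1" for z
  proof -
    have sq: "(w powr (c / 2))\<^sup>2 = w powr c" if "w \<ge> 0" for w c :: real
      using that by (simp add: power2_eq_square flip: powr_add)
    have xe: "p - (p + q) / 2 * Re z = (p - q) / 2" and re: "q / 2 * Re z = q / 2"
      using z by (auto simp: field_simps)
    have HSx: "(\<Sum>k<n. (cmod (Xt z k))\<^sup>2) = x powr p"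
    proof -
      have "(\<Sum>k<n. (cmod (Xt z k))\<^sup>2) = x powr (p - q) * x powr q"
        unfolding norms x xe re by (simp add: power_mult_distrib sq nonneg sum_distrib_left)
      then show ?thesis by (simp flip: powr_add)
    qed
    have HSy: "(\<Sum>k<n. (cmod (Yt z k))\<^sup>2) = y powr p"
    proof -
      have "(\<Sum>k<n. (cmod (Yt z k))\<^sup>2) = y powr (p - q) * y powr q"
        unfolding norms y xe re by (simp add: power_mult_distrib sq nonneg sum_distrib_left)
      then show ?thesis by (simp flip: powr_add)
    qed
    have e1: "p - p / 2 * Re z = p / 2" using z by simp
    have HSa: "(\<Sum>k<n. (cmod (At z k))\<^sup>2) = (\<Sum>k<n. \<alpha> k powr p)" "(\<Sum>k<n. (cmod (Bt z k))\<^sup>2) = (\<Sum>k<n. \<beta> k powr p)"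
      unfolding norms e1 by (simp_all add: sq nonneg)
    have "(cmod (F z))\<^sup>2 \<le> 2 * ((\<Sum>i<n. \<Sum>j<n. (cmod (Xz z i j))\<^sup>2) + (\<Sum>i<n. \<Sum>j<n. (cmod (Yz z i j))\<^sup>2)) *
     ((\<Sum>i<n. \<Sum>j<n. (cmod (Az z i j))\<^sup>2) + (\<Sum>i<n. \<Sum>j<n. (cmod (Bz z i j))\<^sup>2))"
      unfolding F_def by (rule pairing_add_diff_le)
    also have "\<dots> \<le> 2 * ((\<Sum>k<n. (cmod (Xt z k))\<^sup>2) + (\<Sum>k<n. (cmod (Yt z k))\<^sup>2)) *
       ((\<Sum>k<n. (cmod (At z k))\<^sup>2) + (\<Sum>k<n. (cmod (Bt z k))\<^sup>2))"
      unfolding Xz_def Yz_def Az_def Bz_def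
      by (intro mult_mono add_mono hilbert_schmidt_dyad_sum_le fam mult_left_mono add_nonneg_nonneg sum_nonneg mult_nonneg_nonneg) auto
    also have "\<dots> = 2 * (N * K)" unfolding HSx HSy HSa N_def K_def by simp
    finally show ?thesis by (rule real_le_rsqrt)
  qed
  have F\<theta>: "F (of_real \<theta>) = pairing n X (\<lambda>i j. A i j + B i j) + pairing n Y (\<lambda>i j. A i j - B i j)"
  proof -
    have one: "complex_of_real w powr e (of_real \<theta>) = of_real w" if "w \<ge> 0" for w
    proof -
      have "e (of_real \<theta>) = of_real (p - p / 2 * \<theta>)" by (simp add: e_def)
      also have "p - p / 2 * \<theta> = 1" using pq' by (simp add: \<theta>_def)
      finally show ?thesis using that powr_of_real[of w 1] by simp
    qed
    have two: "complex_of_real w powr s (of_real \<theta>) * complex_of_real (h k) powr r (of_real \<theta>) = of_real (h k)"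
      if w: "w \<ge> 0" "w powr q = (\<Sum>k<n. h k powr q)" and h: "\<And>k. h k \<ge> 0" and k: "k < n" for w h k
    \<comment> \<open>For \<open>w = 0\<close> the convention \<open>0 powr 0 = 0\<close> makes the first factor vanish; then \<open>h k = 0\<close> as well.\<close>
    proof (cases "w = 0")
      case True
      then have "\<forall>k\<in>{..<n}. h k powr q = 0" using w(2) by (subst sum_nonneg_eq_0_iff[symmetric]) auto
      then have "h k = 0" using k by auto
      then show ?thesis by simp
    next
      case False
      have "s (of_real \<theta>) = of_real (p - (p + q) / 2 * \<theta>)" by (simp add: s_def field_simps)
      also have "p - (p + q) / 2 * \<theta> = 0" using pq' q0 by (simp add: \<theta>_def field_simps)
      finally have s: "s (of_real \<theta>) = 0" by simp
      have "r (of_real \<theta>) = of_real (q / 2 * \<theta>)" by (simp add: r_def)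
      also have "q / 2 * \<theta> = 1" using q0 by (simp add: \<theta>_def)
      finally show ?thesis using s False h[of k] powr_of_real[of "h k" 1] by simp
    qed
    have "Az (of_real \<theta>) = A" "Bz (of_real \<theta>) = B"
      unfolding Az_def Bz_def A_def B_def At_def Bt_def by (simp_all add: one nonneg)
    moreover have "Xz (of_real \<theta>) = X" "Yz (of_real \<theta>) = Y"
      unfolding Xz_def Yz_def X_def Y_def Xt_def Yt_def
      by (intro dyad_sum_cong two nonneg x y; assumption)+
    ultimately show ?thesis unfolding F_def by simp
  qed
  \<comment> \<open>The three lines theorem asks for positive bounds, so \<open>N K\<close>, which may vanish, is enlarged by \<open>\<epsilon>\<close>.\<close>
  have step: "cmod (F (of_real \<theta>)) \<le> 2 powr (1 / q) * (N * K + \<epsilon>) powr (1 / p)" if \<epsilon>: "\<epsilon> > 0" for \<epsilon>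
  proof -
    define L where "L = N * K + \<epsilon>"
    have L: "L > 0" "N * K \<le> L" using N0 K0 \<epsilon> by (auto simp: L_def add_nonneg_pos)
    have "cmod (F (of_real \<theta>)) \<le> L powr (1 - \<theta>) * sqrt (2 * L) powr \<theta>"
    proof (rule three_lines)
      show "F holomorphic_on {z. 0 < Re z \<and> Re z < 1}" using holo by (rule holomorphic_on_subset) auto
      show "continuous_on {z. 0 \<le> Re z \<and> Re z \<le> 1} F"
        using holomorphic_on_imp_continuous_on[OF holo] by (rule continuous_on_subset) auto
      show "cmod (F z) \<le> L" if "Re z = 0" for z using line0[OF that] L by simp
      show "cmod (F z) \<le> sqrt (2 * L)" if "Re z = 1" for z
        using line1[OF that] L by (smt (verit) real_sqrt_le_mono)
    qed (use M L \<theta> in auto)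
    also have "sqrt (2 * L) powr \<theta> = 2 powr (1 / q) * L powr (1 / q)"
      using L by (simp add: powr_half_sqrt[symmetric] powr_powr powr_mult \<theta>_def)
    also have "L powr (1 - \<theta>) * (2 powr (1 / q) * L powr (1 / q)) = 2 powr (1 / q) * L powr (1 - \<theta> + 1 / q)"
      by (simp add: powr_add)
    also have "1 - \<theta> + 1 / q = 1 / p" using pq by (simp add: \<theta>_def field_simps)
    finally show ?thesis unfolding L_def .
  qed
  have lim: "((\<lambda>\<epsilon>. 2 powr (1 / q) * (N * K + \<epsilon>) powr (1 / p)) \<longlongrightarrow> 2 powr (1 / q) * (N * K + 0) powr (1 / p)) (at_right 0)"
  proof (intro tendsto_mult tendsto_const tendsto_powr' tendsto_add tendsto_ident_at disjI2 conjI)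
    show "0 < 1 / p" using p by simp
    show "\<forall>\<^sub>F \<epsilon> in at_right 0. 0 \<le> N * K + \<epsilon>"
      using eventually_at_right_less[of "0::real"] by eventually_elim (use N0 K0 in auto)
  qed
  have "cmod (F (of_real \<theta>)) \<le> 2 powr (1 / q) * (N * K + 0) powr (1 / p)"
    by (rule tendsto_lowerbound[OF lim])
      (auto intro: step eventually_mono[OF eventually_at_right_less[of 0]])
  then show ?thesis unfolding F\<theta> N_def[symmetric] K_def[symmetric]
    using N0 K0 by (simp add: powr_mult)
qed

section \<open>Clarkson's inequalities in terms of singular values\<close>

text \<open>A singular value decomposition of the leading \<open>n \<times> n\<close> block of \<open>A\<close>. Only the singular vectors of
  nonzero singular values have to be unit vectors.\<close>

definition svd :: "nat \<Rightarrow> (nat \<Rightarrow> nat \<Rightarrow> complex) \<Rightarrow> (nat \<Rightarrow> real) \<Rightarrow> (nat \<Rightarrow> nat \<Rightarrow> complex)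
    \<Rightarrow> (nat \<Rightarrow> nat \<Rightarrow> complex) \<Rightarrow> bool" where
  "svd n A s u v \<longleftrightarrow> (\<forall>k. s k \<ge> 0) \<and> orthofam n n u \<and> orthofam n n v \<and>
     (\<forall>k<n. s k \<noteq> 0 \<longrightarrow> normsq n (u k) = 1 \<and> normsq n (v k) = 1) \<and>
     (\<forall>i<n. \<forall>j<n. A i j = dyad_sum n (\<lambda>k. of_real (s k)) u v i j)"

lemma pairing_cong:
  "(\<And>i j. i < n \<Longrightarrow> j < n \<Longrightarrow> X i j = X' i j) \<Longrightarrow> (\<And>i j. i < n \<Longrightarrow> j < n \<Longrightarrow> A i j = A' i j)
    \<Longrightarrow> pairing n X A = pairing n X' A'"
  by (simp add: pairing_def)

text \<open>Conjugating the singular vectors of \<open>C\<close> gives a matrix whose pairing with \<open>C\<close> only sees the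
  coefficients. Extremizers of the duality between \<open>S\<^sup>p\<close> and \<open>S\<^sup>q\<close> have this form.\<close>

lemma pairing_dual:
  assumes "svd n C c u v"
  shows "pairing n (dyad_sum n t (\<lambda>k i. cnj (u k i)) (\<lambda>k i. cnj (v k i))) C = (\<Sum>k<n. of_real (c k) * t k)"
proof -
  have herm_inner_cnj: "herm_inner n (\<lambda>i. cnj (x i)) (\<lambda>i. cnj (y i)) = cnj (herm_inner n x y)" for x y by (simp add: herm_inner_def)
  have "pairing n (dyad_sum n t (\<lambda>k i. cnj (u k i)) (\<lambda>k i. cnj (v k i))) C
      = pairing n (dyad_sum n t (\<lambda>k i. cnj (u k i)) (\<lambda>k i. cnj (v k i))) (dyad_sum n (\<lambda>k. of_real (c k)) u v)"
    using assms by (intro pairing_cong) (auto simp: svd_def)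
  also have "\<dots> = (\<Sum>k<n. of_real (c k) * (\<Sum>l<n. t l * (cnj (herm_inner n (u l) (u k)) * herm_inner n (v l) (v k))))"
    unfolding pairing_dyad_sum by (simp add: herm_inner_cnj)
  also have "\<dots> = (\<Sum>k<n. of_real (c k) * (\<Sum>l<n. if l = k then t k * of_real (normsq n (u k) * normsq n (v k)) else 0))"
    using assms unfolding svd_def orthofam_def
    by (intro sum.cong arg_cong2[of _ _ _ _ "(*)"] refl) (auto simp: herm_inner_self)
  also have "\<dots> = (\<Sum>k<n. of_real (c k) * t k)"
    using assms by (intro sum.cong refl) (auto simp: svd_def)
  finally show ?thesis .
qed

text \<open>What remains after the dual matrices have been inserted: the quantity \<open>Z\<close> to be estimated
  appears on both sides, and \<open>1 - 1/p = 1/q\<close>.\<close>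

lemma powr_self_bound:
  fixes Z N p q :: real
  assumes "p > 1" "q > 1" "1 / p + 1 / q = 1" "Z \<ge> 0" "N \<ge> 0"
    and le: "Z \<le> 2 powr (1 / q) * N powr (1 / p) * Z powr (1 / p)"
  shows "Z \<le> 2 * N powr (q / p)"
proof (cases "Z = 0")
  case False
  then have Z: "Z > 0" using assms by simp
  have "Z powr (1 / q) * Z powr (1 / p) = Z" using assms Z by (simp flip: powr_add add: add.commute)
  then have "Z powr (1 / q) * Z powr (1 / p) \<le> 2 powr (1 / q) * N powr (1 / p) * Z powr (1 / p)" using le by simp
  then have "Z powr (1 / q) \<le> 2 powr (1 / q) * N powr (1 / p)" using Z by simp
  then have "(Z powr (1 / q)) powr q \<le> (2 powr (1 / q) * N powr (1 / p)) powr q"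
    using assms by (intro powr_mono2) auto
  then show ?thesis using assms Z by (simp add: powr_powr powr_mult)
qed (use assms in simp)

lemma mult_powr_pred: "x * x powr (p - 1) = x powr p" if "x \<ge> 0" for x p :: real
  using that by (cases "x = 0") (auto simp: powr_diff)

text \<open>Let \<open>c = \<parallel>A + B\<parallel>\<^sub>p\<close>, \<open>d = \<parallel>A - B\<parallel>\<^sub>p\<close>. The matrices \<open>X\<close>, \<open>Y\<close> dual to \<open>A + B\<close>, \<open>A - B\<close>, scaled to
  \<open>\<parallel>X\<parallel>\<^sub>q = c\<^bsup>q - 1\<^esup>\<close> and \<open>\<parallel>Y\<parallel>\<^sub>q = d\<^bsup>q - 1\<^esup>\<close>, make both the pairing and \<open>\<parallel>X\<parallel>\<^sub>q\<^sup>p + \<parallel>Y\<parallel>\<^sub>q\<^sup>p\<close> equal to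
  \<open>c\<^sup>q + d\<^sup>q\<close>.\<close>

lemma clarkson_svd_le_2:
  fixes p q :: real
  assumes p: "1 < p" "p \<le> 2" and pq: "1 / p + 1 / q = 1" "q > 1"
    and A: "svd n A \<alpha> u v" and B: "svd n B \<beta> u' v'"
    and C: "svd n (\<lambda>i j. A i j + B i j) \<gamma> a b" and D: "svd n (\<lambda>i j. A i j - B i j) \<delta> a' b'"
  shows "(\<Sum>k<n. \<gamma> k powr p) powr (q / p) + (\<Sum>k<n. \<delta> k powr p) powr (q / p)
    \<le> 2 * ((\<Sum>k<n. \<alpha> k powr p) + (\<Sum>k<n. \<beta> k powr p)) powr (q / p)"
proof -
  define c where "c = (\<Sum>k<n. \<gamma> k powr p) powr (1 / p)"
  define d where "d = (\<Sum>k<n. \<delta> k powr p) powr (1 / p)"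
  have c0: "c \<ge> 0" "d \<ge> 0" by (auto simp: c_def d_def)
  have pq': "(p - 1) * q = p" "p * q = p + q" "(q - 1) * p = q" using pq p by (auto simp: field_simps)
  have cp: "c powr p = (\<Sum>k<n. \<gamma> k powr p)" "d powr p = (\<Sum>k<n. \<delta> k powr p)"
    using p by (auto simp: c_def d_def powr_powr sum_nonneg)
  have cq: "c powr q = (\<Sum>k<n. \<gamma> k powr p) powr (q / p)" "d powr q = (\<Sum>k<n. \<delta> k powr p) powr (q / p)"
    using p by (auto simp: c_def d_def powr_powr)
  have nn: "\<alpha> k \<ge> 0" "\<beta> k \<ge> 0" "\<gamma> k \<ge> 0" "\<delta> k \<ge> 0" for k using A B C D by (auto simp: svd_def)
  \<comment> \<open>Singular values of the dual matrix; its \<open>q\<close>-norm is \<open>c powr (q - 1)\<close>.\<close>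
  define dual where "dual = (\<lambda>c (s :: nat \<Rightarrow> real) k. c powr (q - p) * s k powr (p - 1))"
  have dual_q: "(c powr (q - 1)) powr q = (\<Sum>k<n. dual c s k powr q)"
    if c: "c \<ge> 0" "c powr p = (\<Sum>k<n. s k powr p)" for c and s :: "nat \<Rightarrow> real"
  proof -
    have "(\<Sum>k<n. dual c s k powr q) = c powr ((q - p) * q) * c powr p"
      unfolding dual_def c(2) using pq' by (simp add: powr_mult powr_powr sum_distrib_left)
    also have "\<dots> = c powr ((q - 1) * q)"
      using pq' by (simp flip: powr_add add: algebra_simps)
    finally show ?thesis by (simp add: powr_powr)
  qed
  have dual_pair: "(\<Sum>k<n. s k * dual c s k) = c powr q"
    if c: "c \<ge> 0" "c powr p = (\<Sum>k<n. s k powr p)" and s: "\<And>k. s k \<ge> 0" for c and s :: "nat \<Rightarrow> real"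
  proof -
    have "(\<Sum>k<n. s k * dual c s k) = c powr (q - p) * c powr p"
      unfolding dual_def c(2) by (simp add: sum_distrib_left mult_powr_pred[OF s, of _ p, symmetric] mult_ac)
    then show ?thesis by (simp flip: powr_add)
  qed
  define X where "X = dyad_sum n (\<lambda>k. of_real (dual c \<gamma> k)) (\<lambda>k i. cnj (a k i)) (\<lambda>k i. cnj (b k i))"
  define Y where "Y = dyad_sum n (\<lambda>k. of_real (dual d \<delta> k)) (\<lambda>k i. cnj (a' k i)) (\<lambda>k i. cnj (b' k i))"
  let ?A = "dyad_sum n (\<lambda>k. of_real (\<alpha> k)) u v" and ?B = "dyad_sum n (\<lambda>k. of_real (\<beta> k)) u' v'"
  have "pairing n X (\<lambda>i j. A i j + B i j) + pairing n Y (\<lambda>i j. A i j - B i j) = of_real (c powr q + d powr q)"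
    unfolding X_def Y_def pairing_dual[OF C] pairing_dual[OF D]
    by (simp add: dual_pair[OF c0(1) cp(1) nn(3), symmetric] dual_pair[OF c0(2) cp(2) nn(4), symmetric])
  moreover have "pairing n X (\<lambda>i j. A i j + B i j) = pairing n X (\<lambda>i j. ?A i j + ?B i j)"
      "pairing n Y (\<lambda>i j. A i j - B i j) = pairing n Y (\<lambda>i j. ?A i j - ?B i j)"
    using A B by (auto intro!: pairing_cong simp: svd_def)
  ultimately have "c powr q + d powr q = cmod (pairing n X (\<lambda>i j. ?A i j + ?B i j) + pairing n Y (\<lambda>i j. ?A i j - ?B i j))"
    by (metis abs_of_nonneg add_nonneg_nonneg norm_of_real powr_ge_zero)
  also have "\<dots> \<le> 2 powr (1 / q) * ((\<Sum>k<n. \<alpha> k powr p) + (\<Sum>k<n. \<beta> k powr p)) powr (1 / p)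
       * ((c powr (q - 1)) powr p + (d powr (q - 1)) powr p) powr (1 / p)"
    unfolding X_def Y_def
    by (intro bilinear_clarkson p pq orthofam_cnj dual_q cp c0 nn)
      (use A B C D in \<open>auto simp: svd_def dual_def\<close>)
  also have "(c powr (q - 1)) powr p + (d powr (q - 1)) powr p = c powr q + d powr q"
    using pq' by (simp add: powr_powr)
  finally show ?thesis unfolding cq[symmetric]
    by (intro powr_self_bound p pq) (auto intro!: add_nonneg_nonneg sum_nonneg)
qed

text \<open>Here the given matrices are the ones measured in \<open>S\<^sup>q\<close>, and \<open>A\<close>, \<open>B\<close> are chosen dual to their sum
  and difference.\<close>

lemma clarkson_svd_ge_2:
  fixes p q :: real
  assumes p: "1 < p" "p \<le> 2" and pq: "1 / p + 1 / q = 1" "q > 1"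
    and X: "svd n X \<xi> u v" and Y: "svd n Y \<eta> u' v'"
    and C: "svd n (\<lambda>i j. X i j + Y i j) \<gamma> a b" and D: "svd n (\<lambda>i j. X i j - Y i j) \<delta> a' b'"
  shows "(\<Sum>k<n. \<gamma> k powr q) + (\<Sum>k<n. \<delta> k powr q)
    \<le> 2 * ((\<Sum>k<n. \<xi> k powr q) powr (p / q) + (\<Sum>k<n. \<eta> k powr q) powr (p / q)) powr (q / p)"
proof -
  define x where "x = (\<Sum>k<n. \<xi> k powr q) powr (1 / q)"
  define y where "y = (\<Sum>k<n. \<eta> k powr q) powr (1 / q)"
  have pq': "(q - 1) * p = q" using pq p by (auto simp: field_simps)
  have xp: "x powr p = (\<Sum>k<n. \<xi> k powr q) powr (p / q)" "y powr p = (\<Sum>k<n. \<eta> k powr q) powr (p / q)"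
    using p by (auto simp: x_def y_def powr_powr)
  have xq: "x powr q = (\<Sum>k<n. \<xi> k powr q)" "y powr q = (\<Sum>k<n. \<eta> k powr q)"
    using pq by (auto simp: x_def y_def powr_powr sum_nonneg)
  have nn: "\<xi> k \<ge> 0" "\<eta> k \<ge> 0" "\<gamma> k \<ge> 0" "\<delta> k \<ge> 0" for k using X Y C D by (auto simp: svd_def)
  define A where "A = dyad_sum n (\<lambda>k. of_real (\<gamma> k powr (q - 1))) (\<lambda>k i. cnj (a k i)) (\<lambda>k i. cnj (b k i))"
  define B where "B = dyad_sum n (\<lambda>k. of_real (\<delta> k powr (q - 1))) (\<lambda>k i. cnj (a' k i)) (\<lambda>k i. cnj (b' k i))"
  let ?X = "dyad_sum n (\<lambda>k. of_real (\<xi> k)) u v" and ?Y = "dyad_sum n (\<lambda>k. of_real (\<eta> k)) u' v'"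
  let ?Z = "(\<Sum>k<n. \<gamma> k powr q) + (\<Sum>k<n. \<delta> k powr q)"
  have "pairing n A (\<lambda>i j. X i j + Y i j) + pairing n B (\<lambda>i j. X i j - Y i j) = of_real ?Z"
    unfolding A_def B_def pairing_dual[OF C] pairing_dual[OF D]
    by (simp add: mult_powr_pred[OF nn(3)] mult_powr_pred[OF nn(4)] flip: of_real_mult of_real_sum)
  moreover have "pairing n A (\<lambda>i j. X i j + Y i j) = pairing n A (\<lambda>i j. ?X i j + ?Y i j)"
      "pairing n B (\<lambda>i j. X i j - Y i j) = pairing n B (\<lambda>i j. ?X i j - ?Y i j)"
    using X Y by (auto intro!: pairing_cong simp: svd_def)
  moreover have "pairing n A (\<lambda>i j. ?X i j + ?Y i j) + pairing n B (\<lambda>i j. ?X i j - ?Y i j)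
     = pairing n ?X (\<lambda>i j. A i j + B i j) + pairing n ?Y (\<lambda>i j. A i j - B i j)"
    unfolding pairing_add_right pairing_diff_right pairing_commute[of n A] pairing_commute[of n B] by simp
  ultimately have "?Z = cmod (pairing n ?X (\<lambda>i j. A i j + B i j) + pairing n ?Y (\<lambda>i j. A i j - B i j))"
    by (metis (no_types, lifting) abs_of_nonneg add_nonneg_nonneg norm_of_real powr_ge_zero sum_nonneg)
  also have "\<dots> \<le> 2 powr (1 / q) * ((\<Sum>k<n. (\<gamma> k powr (q - 1)) powr p) + (\<Sum>k<n. (\<delta> k powr (q - 1)) powr p)) powr (1 / p)
       * (x powr p + y powr p) powr (1 / p)"
    unfolding A_def B_def
    by (intro bilinear_clarkson p pq orthofam_cnj xq nn)
      (use X Y C D in \<open>auto simp: svd_def x_def y_def\<close>)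
  finally have "?Z \<le> 2 powr (1 / q) * (x powr p + y powr p) powr (1 / p) * ?Z powr (1 / p)"
    using pq' by (simp add: powr_powr mult_ac)
  then show ?thesis unfolding xp[symmetric]
    by (intro powr_self_bound p pq) (auto intro!: add_nonneg_nonneg sum_nonneg)
qed

section \<open>An orthonormal basis with orthogonal images\<close>

definition mat_app :: "nat \<Rightarrow> (nat \<Rightarrow> nat \<Rightarrow> complex) \<Rightarrow> (nat \<Rightarrow> complex) \<Rightarrow> nat \<Rightarrow> complex" where
  "mat_app n A x i = (\<Sum>j<n. A i j * x j)"

definition orthonormal :: "nat \<Rightarrow> nat \<Rightarrow> (nat \<Rightarrow> nat \<Rightarrow> complex) \<Rightarrow> bool" where
  "orthonormal n m e \<longleftrightarrow> (\<forall>k<m. \<forall>l<m. herm_inner n (e k) (e l) = (if k = l then 1 else 0))"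

lemma orthonormal_normsq: "orthonormal n m e \<Longrightarrow> k < m \<Longrightarrow> normsq n (e k) = 1"
  unfolding orthonormal_def using herm_inner_self[of n "e k"] by (metis of_real_eq_1_iff)

lemma orthonormal_imp_orthofam: "orthonormal n m e \<Longrightarrow> orthofam n m e"
  using orthonormal_normsq[of n m e] by (auto simp: orthonormal_def orthofam_def)

lemma herm_inner_scale_left: "herm_inner n (\<lambda>i. c * x i) y = c * herm_inner n x y"
  by (simp add: herm_inner_def sum_distrib_left mult.assoc)

lemma herm_inner_scale_right: "herm_inner n x (\<lambda>i. c * y i) = cnj c * herm_inner n x y"
  by (simp add: herm_inner_def sum_distrib_left mult_ac)

lemma herm_inner_diff_left: "herm_inner n (\<lambda>i. x i - y i) z = herm_inner n x z - herm_inner n y z"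
  by (simp add: herm_inner_def left_diff_distrib sum_subtractf)

lemma herm_inner_add_left: "herm_inner n (\<lambda>i. x i + y i) z = herm_inner n x z + herm_inner n y z"
  by (simp add: herm_inner_def distrib_right sum.distrib)

lemma normsq_scale: "normsq n (\<lambda>i. c * x i) = (cmod c)\<^sup>2 * normsq n x"
  by (simp add: normsq_def norm_mult power_mult_distrib sum_distrib_left)

lemma mat_app_add: "mat_app n A (\<lambda>i. x i + y i) = (\<lambda>i. mat_app n A x i + mat_app n A y i)"
  by (simp add: mat_app_def fun_eq_iff distrib_left sum.distrib)

lemma mat_app_scale: "mat_app n A (\<lambda>i. c * x i) = (\<lambda>i. c * mat_app n A x i)"
  by (simp add: mat_app_def fun_eq_iff sum_distrib_left mult_ac)

lemma normsq_eq_0_iff: "normsq n x = 0 \<longleftrightarrow> (\<forall>i<n. x i = 0)"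
  by (auto simp: normsq_def sum_nonneg_eq_0_iff)

text \<open>The squared norms of the projections of the \<open>n\<close> standard unit vectors to the span of the \<open>e\<^sub>k\<close> add
  up to \<open>m < n\<close>, so one standard unit vector is not in the span. Subtract its projection and
  normalize.\<close>

lemma exists_unit_orthogonal:
  assumes e: "orthonormal n m e" and "m < n"
  shows "\<exists>x. normsq n x = 1 \<and> (\<forall>k<m. herm_inner n x (e k) = 0) \<and> (\<forall>i\<ge>n. x i = 0)"
proof -
  have "(\<Sum>j<n. \<Sum>k<m. (cmod (e k j))\<^sup>2) = (\<Sum>k<m. normsq n (e k))"
    unfolding normsq_def by (rule sum.swap)
  also have "\<dots> = m" using orthonormal_normsq[OF e] by simp
  finally have "(\<Sum>j<n. \<Sum>k<m. (cmod (e k j))\<^sup>2) < (\<Sum>j<n. 1)" using \<open>m < n\<close> by simp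
  then obtain j where j: "j < n" "(\<Sum>k<m. (cmod (e k j))\<^sup>2) < 1"
    by (metis (no_types, lifting) lessThan_iff not_le sum_mono)
  define d where "d = (\<lambda>i. if i = j then 1 else 0 :: complex)"
  have ipd: "herm_inner n d x = cnj (x j)" for x
    using j(1) by (simp add: herm_inner_def d_def if_distrib[of "\<lambda>z. z * _"] cong: if_cong)
  define s where "s = (\<lambda>i. \<Sum>k<m. cnj (e k j) * e k i)"
  define y where "y = (\<lambda>i. d i - s i)"
  have ips: "herm_inner n s (e l) = cnj (e l j)" if "l < m" for l
  proof -
    have "herm_inner n s (e l) = (\<Sum>k<m. cnj (e k j) * (if k = l then 1 else 0))"
      unfolding s_def herm_inner_sum_left using e that by (intro sum.cong refl) (auto simp: orthonormal_def)
    then show ?thesis using that by (simp add: if_distrib cong: if_cong)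
  qed
  have yorth: "herm_inner n y (e l) = 0" if "l < m" for l
    unfolding y_def herm_inner_diff_left using ips[OF that] by (simp add: ipd)
  have "normsq n y \<noteq> 0"
  proof
    assume "normsq n y = 0"
    then have "s j = 1" using j(1) unfolding normsq_eq_0_iff y_def d_def by force
    moreover have "s j = of_real (\<Sum>k<m. (cmod (e k j))\<^sup>2)"
      unfolding s_def by (simp add: complex_norm_square mult.commute del: of_real_power)
    ultimately show False using j(2) by (metis less_irrefl of_real_eq_1_iff)
  qed
  then have ny: "normsq n y > 0" using normsq_nonneg[of n y] by linarith
  define x where "x = (\<lambda>i. if i < n then of_real (1 / sqrt (normsq n y)) * y i else 0)"
  have "normsq n x = normsq n (\<lambda>i. of_real (1 / sqrt (normsq n y)) * y i)"
    unfolding x_def normsq_def by simp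
  also have "\<dots> = 1" unfolding normsq_scale norm_of_real using ny by (simp add: power_divide)
  finally have "normsq n x = 1" .
  moreover have "herm_inner n x (e k) = 0" if "k < m" for k
  proof -
    have "herm_inner n x (e k) = herm_inner n (\<lambda>i. of_real (1 / sqrt (normsq n y)) * y i) (e k)"
      unfolding x_def herm_inner_def by simp
    then show ?thesis unfolding herm_inner_scale_left using yorth[OF that] by simp
  qed
  ultimately show ?thesis by (intro exI[of _ x]) (simp add: x_def)
qed

lemma compact_finite_support_unit_box:
  "compact {x :: nat \<Rightarrow> complex. \<forall>i. x i \<in> (if i < n then cball 0 1 else {0})}"
proof -
  have "compactin (product_topology (\<lambda>i::nat. euclidean) UNIV)
      (PiE UNIV (\<lambda>i. if i < n then cball (0::complex) 1 else {0}))"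
    by (subst compactin_PiE) auto
  moreover have "PiE UNIV (\<lambda>i. if i < n then cball (0::complex) 1 else {0}) = {x. \<forall>i. x i \<in> (if i < n then cball 0 1 else {0})}"
    by (simp only: PiE_UNIV_domain Pi_def UNIV_I simp_thms)
  ultimately show ?thesis by (simp only: euclidean_product_topology compactin_euclidean_iff)
qed

text \<open>A continuous function attains its maximum on the compact set of unit vectors in the orthogonal
  complement. Homogeneity extends the bound to the whole complement.\<close>

lemma exists_maximizing_unit:
  assumes e: "orthonormal n m e" and "m < n"
  shows "\<exists>x. normsq n x = 1 \<and> (\<forall>k<m. herm_inner n x (e k) = 0) \<and>
     (\<forall>y. (\<forall>k<m. herm_inner n y (e k) = 0) \<longrightarrow> normsq n (mat_app n A y) \<le> normsq n (mat_app n A x) * normsq n y)"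
proof -
  \<comment> \<open>Coordinates beyond \<open>n\<close> are fixed to \<open>0\<close>: without this the set would not be compact.\<close>
  let ?Q = "{x :: nat \<Rightarrow> complex. \<forall>i. x i \<in> (if i < n then cball 0 1 else {0})}"
  define K where "K = ?Q \<inter> {x. normsq n x = 1} \<inter> (\<Inter>k\<in>{..<m}. {x. herm_inner n x (e k) = 0})"
  have "compact K"
    unfolding K_def normsq_def herm_inner_def
    by (intro compact_Int_closed compact_finite_support_unit_box closed_INT ballI closed_Collect_eq
        continuous_intros continuous_on_product_coordinates)
  have inK: "x \<in> K" if x: "normsq n x = 1" "\<forall>k<m. herm_inner n x (e k) = 0" "\<forall>i\<ge>n. x i = 0" for x
  proof -
    have "cmod (x i) \<le> 1" if "i < n" for i
    proof -
      have "(cmod (x i))\<^sup>2 \<le> normsq n x"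
        unfolding normsq_def using that by (intro member_le_sum) auto
      then show ?thesis using x(1) by (metis abs_norm_cancel abs_square_le_1)
    qed
    then show ?thesis using x by (auto simp: K_def)
  qed
  then have "K \<noteq> {}" using exists_unit_orthogonal[OF assms] by blast
  have cont: "continuous_on K (\<lambda>x. normsq n (mat_app n A x))"
    unfolding normsq_def mat_app_def
    by (rule continuous_on_subset[OF _ subset_UNIV])
      (intro continuous_intros continuous_on_product_coordinates)
  obtain x where x: "x \<in> K" and max: "\<And>y. y \<in> K \<Longrightarrow> normsq n (mat_app n A y) \<le> normsq n (mat_app n A x)"
    using continuous_attains_sup[OF \<open>compact K\<close> \<open>K \<noteq> {}\<close> cont] by blast
  have "normsq n (mat_app n A y) \<le> normsq n (mat_app n A x) * normsq n y" if y: "\<forall>k<m. herm_inner n y (e k) = 0" for y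
  proof (cases "normsq n y = 0")
    case True
    then have "normsq n (mat_app n A y) = 0" by (simp add: normsq_eq_0_iff mat_app_def)
    then show ?thesis using True by simp
  next
    case False
    then have ny: "normsq n y > 0" using normsq_nonneg[of n y] by linarith
    define c where "c = complex_of_real (1 / sqrt (normsq n y))"
    have c2: "(cmod c)\<^sup>2 = 1 / normsq n y" unfolding c_def norm_of_real using ny by (simp add: power_divide)
    define z where "z = (\<lambda>i. if i < n then c * y i else 0)"
    have "normsq n z = normsq n (\<lambda>i. c * y i)" unfolding z_def normsq_def by simp
    then have "normsq n z = 1" unfolding normsq_scale c2 using ny by simp
    moreover have "herm_inner n z (e k) = herm_inner n (\<lambda>i. c * y i) (e k)" for k unfolding z_def herm_inner_def by simp
    then have "\<forall>k<m. herm_inner n z (e k) = 0" using y by (simp add: herm_inner_scale_left)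
    ultimately have "z \<in> K" by (intro inK) (auto simp: z_def)
    then have "normsq n (mat_app n A z) \<le> normsq n (mat_app n A x)" by (rule max)
    moreover have "mat_app n A z = mat_app n A (\<lambda>i. c * y i)" by (simp add: mat_app_def z_def fun_eq_iff)
    ultimately have "1 / normsq n y * normsq n (mat_app n A y) \<le> normsq n (mat_app n A x)"
      by (simp add: mat_app_scale normsq_scale c2)
    then show ?thesis using ny by (simp add: field_simps)
  qed
  then show ?thesis using x by (intro exI[of _ x]) (auto simp: K_def)
qed

lemma normsq_add: "normsq n (\<lambda>i. x i + y i) = normsq n x + 2 * Re (herm_inner n x y) + normsq n y"
  using normsq_diff[of n x "\<lambda>i. (-1) * y i"] unfolding normsq_scale
  by (simp add: herm_inner_def sum_negf)

text \<open>First variation: perturbing \<open>x\<close> by \<open>r w y\<close> with \<open>w = \<langle>A x, A y\<rangle>\<close> raises \<open>|A x|\<^sup>2\<close> by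
  at least \<open>2 r |w|\<^sup>2\<close>, while the bound grows only like \<open>r\<^sup>2\<close>. For small \<open>r > 0\<close> this
  forces \<open>w = 0\<close>.\<close>

lemma maximizer_orthogonal:
  assumes x: "normsq n x = 1" and yx: "herm_inner n y x = 0"
    and max: "\<And>c. normsq n (mat_app n A (\<lambda>i. x i + c * y i)) \<le> normsq n (mat_app n A x) * normsq n (\<lambda>i. x i + c * y i)"
  shows "herm_inner n (mat_app n A y) (mat_app n A x) = 0"
proof (rule ccontr)
  define w where "w = herm_inner n (mat_app n A x) (mat_app n A y)"
  assume "herm_inner n (mat_app n A y) (mat_app n A x) \<noteq> 0"
  then have w: "w \<noteq> 0" unfolding w_def by (subst herm_inner_commute) simp
  define M where "M = normsq n (mat_app n A x) * normsq n y"
  have ineq: "2 * r * (cmod w)\<^sup>2 \<le> r\<^sup>2 * (cmod w)\<^sup>2 * M" if r: "r > 0" for r :: real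
  proof -
    define c where "c = of_real r * w"
    have xy: "herm_inner n x y = 0" using yx by (subst herm_inner_commute) simp
    have "normsq n (mat_app n A (\<lambda>i. x i + c * y i))
       = normsq n (mat_app n A x) + 2 * Re (cnj c * w) + (cmod c)\<^sup>2 * normsq n (mat_app n A y)"
      unfolding mat_app_add mat_app_scale normsq_add herm_inner_scale_right normsq_scale w_def[symmetric] by simp
    moreover have "normsq n (\<lambda>i. x i + c * y i) = 1 + (cmod c)\<^sup>2 * normsq n y"
      unfolding normsq_add herm_inner_scale_right normsq_scale xy x by simp
    ultimately have "2 * Re (cnj c * w) + (cmod c)\<^sup>2 * normsq n (mat_app n A y) \<le> (cmod c)\<^sup>2 * M"
      using max[of c] by (simp add: M_def algebra_simps)
    moreover have "cnj c * w = of_real (r * (cmod w)\<^sup>2)"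
      by (simp add: c_def complex_norm_square mult_ac del: of_real_power)
    ultimately have "2 * (r * (cmod w)\<^sup>2) + (cmod c)\<^sup>2 * normsq n (mat_app n A y) \<le> (cmod c)\<^sup>2 * M"
      by (metis Re_complex_of_real)
    then have "2 * (r * (cmod w)\<^sup>2) \<le> (cmod c)\<^sup>2 * M"
      using mult_nonneg_nonneg[OF zero_le_power2[of "cmod c"] normsq_nonneg[of n "mat_app n A y"]] by linarith
    then show ?thesis using r by (simp add: c_def norm_mult power_mult_distrib mult.assoc)
  qed
  define r where "r = 1 / (M + 1)"
  have M: "M \<ge> 0" by (simp add: M_def)
  then have r: "r > 0" by (simp add: r_def)
  then have "2 \<le> r * M" using ineq[OF r] w by (simp add: power2_eq_square)
  also have "r * M \<le> 1" using M by (simp add: r_def)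
  finally show False by simp
qed

text \<open>The images of the vectors found so far have to be orthogonal to the images of everything that can
  still be chosen; this invariant makes the induction work.\<close>

lemma exists_orthonormal_orthogonal_images:
  assumes "m \<le> n"
  shows "\<exists>e. orthonormal n m e \<and>
    (\<forall>k<m. \<forall>y. (\<forall>l\<le>k. herm_inner n y (e l) = 0) \<longrightarrow> herm_inner n (mat_app n A y) (mat_app n A (e k)) = 0)"
  using assms
proof (induction m)
  case 0
  then show ?case by (simp add: orthonormal_def)
next
  case (Suc m)
  then obtain e where e: "orthonormal n m e"
    and im: "\<forall>k<m. \<forall>y. (\<forall>l\<le>k. herm_inner n y (e l) = 0) \<longrightarrow> herm_inner n (mat_app n A y) (mat_app n A (e k)) = 0"
    by auto
  obtain x where x: "normsq n x = 1" "\<forall>k<m. herm_inner n x (e k) = 0"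
    and max: "\<forall>y. (\<forall>k<m. herm_inner n y (e k) = 0) \<longrightarrow> normsq n (mat_app n A y) \<le> normsq n (mat_app n A x) * normsq n y"
    using exists_maximizing_unit[OF e, of A] Suc.prems by auto
  have ex: "herm_inner n (e k) x = 0" if "k < m" for k using x(2) that by (subst herm_inner_commute) simp
  let ?e = "e(m := x)"
  have "orthonormal n (Suc m) ?e"
    using e x ex by (auto simp: orthonormal_def less_Suc_eq herm_inner_self)
  moreover have "herm_inner n (mat_app n A y) (mat_app n A (?e k)) = 0"
    if k: "k < Suc m" and y: "\<forall>l\<le>k. herm_inner n y (?e l) = 0" for k y
  proof (cases "k = m")
    case False
    then have "\<forall>l\<le>k. herm_inner n y (e l) = 0" using y k by auto
    then show ?thesis using im k False by auto
  next
    case True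
    have ye: "herm_inner n y (e l) = 0" if "l < m" for l using y that True by (auto dest!: spec[of _ l])
    have yx: "herm_inner n y x = 0" using y True by auto
    have "herm_inner n (mat_app n A y) (mat_app n A x) = 0"
      by (rule maximizer_orthogonal[OF x(1) yx]) (use max x(2) ye in \<open>simp add: herm_inner_add_left herm_inner_scale_left\<close>)
    then show ?thesis using True by simp
  qed
  ultimately show ?case by blast
qed

lemma exists_orthonormal_basis_orthogonal_images:
  "\<exists>e. orthonormal n n e \<and> (\<forall>k<n. \<forall>l<n. k \<noteq> l \<longrightarrow> herm_inner n (mat_app n A (e k)) (mat_app n A (e l)) = 0)"
proof -
  obtain e where e: "orthonormal n n e"
    and im: "\<And>k y. k < n \<Longrightarrow> \<forall>l\<le>k. herm_inner n y (e l) = 0 \<Longrightarrow> herm_inner n (mat_app n A y) (mat_app n A (e k)) = 0"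
    using exists_orthonormal_orthogonal_images[of n n A] by auto
  have "herm_inner n (mat_app n A (e k)) (mat_app n A (e l)) = 0" if "k < n" "l < k" for k l
    using that e by (intro im) (auto simp: orthonormal_def)
  then have "herm_inner n (mat_app n A (e k)) (mat_app n A (e l)) = 0" if "k < n" "l < n" "k \<noteq> l" for k l
    using that herm_inner_commute[of n "mat_app n A (e k)" "mat_app n A (e l)"] by (metis complex_cnj_zero nat_neq_iff)
  with e show ?thesis by blast
qed

section \<open>Functional calculus and Schatten norms\<close>

lemma mat_adjoint_carrier [simp]: "A \<in> carrier_mat m n \<Longrightarrow> mat_adjoint A \<in> carrier_mat n m"
  unfolding mat_adjoint_def by (auto simp: mat_of_rows_def)

lemma mat_adjoint_index:
  "i < dim_col A \<Longrightarrow> j < dim_row A \<Longrightarrow> mat_adjoint (A :: complex mat) $$ (i, j) = cnj (A $$ (j, i))"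
  unfolding mat_adjoint_def by (simp add: mat_of_rows_def conjugate_complex_def)

lemma mat_mult_index:
  "A \<in> carrier_mat m n \<Longrightarrow> B \<in> carrier_mat n r \<Longrightarrow> i < m \<Longrightarrow> j < r
    \<Longrightarrow> (A * B) $$ (i, j) = (\<Sum>k<n. A $$ (i, k) * B $$ (k, j))"
  by (auto simp: scalar_prod_def atLeast0LessThan)

lemma mat_adjoint_mult:
  fixes A B :: "complex mat"
  assumes "A \<in> carrier_mat m n" "B \<in> carrier_mat n r"
  shows "mat_adjoint (A * B) = mat_adjoint B * mat_adjoint A"
proof (rule eq_matI)
  have c: "mat_adjoint (A * B) \<in> carrier_mat r m" "mat_adjoint B * mat_adjoint A \<in> carrier_mat r m"
    using mat_adjoint_carrier[OF mult_carrier_mat[OF assms]]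
      mult_carrier_mat[OF mat_adjoint_carrier[OF assms(2)] mat_adjoint_carrier[OF assms(1)]] .
  fix i j assume "i < dim_row (mat_adjoint B * mat_adjoint A)" "j < dim_col (mat_adjoint B * mat_adjoint A)"
  then have ij: "i < r" "j < m" using c by auto
  have "mat_adjoint (A * B) $$ (i, j) = cnj ((A * B) $$ (j, i))"
    using assms ij by (intro mat_adjoint_index) auto
  also have "\<dots> = (\<Sum>k<n. cnj (A $$ (j, k)) * cnj (B $$ (k, i)))"
    using mat_mult_index[OF assms ij(2,1)] by simp
  also have "\<dots> = (\<Sum>k<n. mat_adjoint B $$ (i, k) * mat_adjoint A $$ (k, j))"
    using assms ij by (intro sum.cong) (auto simp: mat_adjoint_index)
  also have "\<dots> = (mat_adjoint B * mat_adjoint A) $$ (i, j)"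
    using assms ij by (intro mat_mult_index[symmetric]) auto
  finally show "mat_adjoint (A * B) $$ (i, j) = (mat_adjoint B * mat_adjoint A) $$ (i, j)" .
qed (use carrier_matD[OF mat_adjoint_carrier[OF mult_carrier_mat[OF assms]]]
    carrier_matD[OF mat_adjoint_carrier[OF assms(1)]] carrier_matD[OF mat_adjoint_carrier[OF assms(2)]] in auto)

lemma unitaryD:
  assumes "U \<in> carrier (unitary_group n)"
  shows "U \<in> carrier_mat n n" "U * mat_adjoint U = 1\<^sub>m n" "mat_adjoint U * U = 1\<^sub>m n"
  using assms mat_mult_left_right_inverse[of U n "mat_adjoint U"] by (auto simp: unitary_group_def)

text \<open>The unitary \<open>W = U'\<^sup>* U\<close> intertwines the two diagonal matrices: \<open>W\<^sub>i\<^sub>j d\<^sub>j = d'\<^sub>i W\<^sub>i\<^sub>j\<close>. Where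
  \<open>W\<^sub>i\<^sub>j \<noteq> 0\<close> the two eigenvalues agree, hence also their images under \<open>f\<close>, so \<open>W\<close> intertwines
  these as well.\<close>

lemma functional_calculus_unique:
  fixes d d' :: "nat \<Rightarrow> real"
  assumes U: "U \<in> carrier (unitary_group n)" and U': "U' \<in> carrier (unitary_group n)"
    and eq: "U * mat_diag n (\<lambda>i. of_real (d i)) * mat_adjoint U = U' * mat_diag n (\<lambda>i. of_real (d' i)) * mat_adjoint U'"
  shows "U * mat_diag n (\<lambda>i. of_real (f (d i))) * mat_adjoint U = U' * mat_diag n (\<lambda>i. of_real (f (d' i))) * mat_adjoint U'"
proof -
  note [simp] = unitaryD[OF U] unitaryD[OF U']
  note square = assoc_mult_mat[of _ n n _ n _ n] mult_carrier_mat[of _ n n _ n]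
    right_mult_one_mat[of _ n n] left_mult_one_mat[of _ n n]
  define V where "V = mat_adjoint U" define V' where "V' = mat_adjoint U'"
  have c[simp]: "U \<in> carrier_mat n n" "U' \<in> carrier_mat n n" "V \<in> carrier_mat n n" "V' \<in> carrier_mat n n"
    by (auto simp: V_def V'_def)
  have inv: "U * V = 1\<^sub>m n" "V * U = 1\<^sub>m n" "U' * V' = 1\<^sub>m n" "V' * U' = 1\<^sub>m n"
    by (auto simp: V_def V'_def)
  define W where "W = V' * U"
  have W[simp]: "W \<in> carrier_mat n n" unfolding W_def by (rule mult_carrier_mat[OF c(4) c(1)])
  let ?D = "\<lambda>g. mat_diag n (\<lambda>i. of_real (g i)) :: complex mat"
  have WD: "W * ?D d = ?D d' * W"
  proof -
    have "W * ?D d = V' * (U * ?D d * V) * U"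
      unfolding W_def by (simp add: square inv)
    also have "\<dots> = V' * (U' * ?D d' * V') * U" using eq by (simp add: V_def V'_def)
    also have "\<dots> = (V' * U') * ?D d' * W"
      unfolding W_def by (simp add: square)
    finally show ?thesis by (simp add: inv left_mult_one_mat[of _ n n])
  qed
  have WF: "W * ?D (\<lambda>i. f (d i)) = ?D (\<lambda>i. f (d' i)) * W"
  proof (rule eq_matI)
    fix i j assume "i < dim_row (?D (\<lambda>i. f (d' i)) * W)" "j < dim_col (?D (\<lambda>i. f (d' i)) * W)"
    then have ij: "i < n" "j < n" using W by (auto simp: mat_diag_def)
    have "W $$ (i, j) * of_real (d j) = of_real (d' i) * W $$ (i, j)"
      using arg_cong[OF WD, of "\<lambda>M. M $$ (i, j)"] ij
      by (simp add: mat_diag_mult_left[OF W] mat_diag_mult_right[OF W])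
    then have "W $$ (i, j) = 0 \<or> d j = d' i" by (auto simp: mult.commute)
    then show "(W * ?D (\<lambda>i. f (d i))) $$ (i, j) = (?D (\<lambda>i. f (d' i)) * W) $$ (i, j)"
      using ij by (auto simp: mat_diag_mult_left[OF W] mat_diag_mult_right[OF W])
  qed (use carrier_matD[OF W] in \<open>auto simp: mat_diag_def\<close>)
  have "U * ?D (\<lambda>i. f (d i)) * V = (U' * V') * U * ?D (\<lambda>i. f (d i)) * V"
    by (simp add: inv left_mult_one_mat[of _ n n])
  also have "\<dots> = U' * (W * ?D (\<lambda>i. f (d i))) * V"
    unfolding W_def by (simp add: square)
  also have "\<dots> = U' * ?D (\<lambda>i. f (d' i)) * V' * (U * V)"
    unfolding WF unfolding W_def by (simp add: square)
  finally show ?thesis by (simp add: inv V_def V'_def square)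
qed

lemma herm_fun_unitary_diag:
  fixes d :: "nat \<Rightarrow> real"
  assumes U: "U \<in> carrier (unitary_group n)"
  shows "herm_fun f (U * mat_diag n (\<lambda>i. of_real (d i)) * mat_adjoint U)
    = U * mat_diag n (\<lambda>i. of_real (f (d i))) * mat_adjoint U" (is "herm_fun f ?A = ?B")
proof -
  have dim: "dim_row ?A = n" using unitaryD(1)[OF U] by auto
  show ?thesis unfolding herm_fun_def dim
  proof (rule the_equality)
    show "\<exists>U\<in>carrier (unitary_group n). \<exists>d. ?A = U * mat_diag n (\<lambda>i. of_real (d i)) * mat_adjoint U
       \<and> ?B = U * mat_diag n (\<lambda>i. of_real (f (d i))) * mat_adjoint U"
      using U by blast
  next
    fix B assume "\<exists>U\<in>carrier (unitary_group n). \<exists>d. ?A = U * mat_diag n (\<lambda>i. of_real (d i)) * mat_adjoint U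
       \<and> B = U * mat_diag n (\<lambda>i. of_real (f (d i))) * mat_adjoint U"
    then obtain U' d' where "U' \<in> carrier (unitary_group n)"
      "?A = U' * mat_diag n (\<lambda>i. of_real (d' i)) * mat_adjoint U'"
      "B = U' * mat_diag n (\<lambda>i. of_real (f (d' i))) * mat_adjoint U'" by blast
    then show "B = ?B" using functional_calculus_unique[OF U, of U' d d' f] by simp
  qed
qed

lemma mat_trace_unitary_diag:
  assumes U: "U \<in> carrier (unitary_group n)"
  shows "mat_trace (U * mat_diag n g * mat_adjoint U) = (\<Sum>k<n. g k)"
proof -
  note C = unitaryD(1)[OF U]
  let ?M = "U * mat_diag n g * mat_adjoint U"
  have M: "?M \<in> carrier_mat n n"
    by (intro mult_carrier_mat[of _ n n] mat_adjoint_carrier mat_diag_dim C)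
  have "mat_trace ?M = (\<Sum>i<n. ?M $$ (i, i))"
    unfolding mat_trace_def diag_mat_def carrier_matD(1)[OF M]
    by (simp add: interv_sum_list_conv_sum_set_nat atLeast0LessThan)
  also have "\<dots> = (\<Sum>i<n. \<Sum>k<n. g k * (mat_adjoint U $$ (k, i) * U $$ (i, k)))"
  proof (intro sum.cong refl)
    fix i assume i: "i \<in> {..<n}"
    have "?M $$ (i, i) = (\<Sum>k<n. (U * mat_diag n g) $$ (i, k) * mat_adjoint U $$ (k, i))"
      using C i by (intro mat_mult_index) auto
    then show "?M $$ (i, i) = (\<Sum>k<n. g k * (mat_adjoint U $$ (k, i) * U $$ (i, k)))"
      using i C by (simp add: mat_diag_mult_right[OF C] mult_ac)
  qed
  also have "\<dots> = (\<Sum>k<n. g k * (\<Sum>i<n. mat_adjoint U $$ (k, i) * U $$ (i, k)))"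
    by (subst sum.swap) (simp add: sum_distrib_left)
  also have "\<dots> = (\<Sum>k<n. g k * (mat_adjoint U * U) $$ (k, k))"
    using C by (intro sum.cong refl arg_cong2[of _ _ _ _ "(*)"] mat_mult_index[symmetric]) auto
  also have "\<dots> = (\<Sum>k<n. g k)" using unitaryD(3)[OF U] by simp
  finally show ?thesis .
qed

text \<open>Both functional calculi in the definition act on the same diagonalization: \<open>|A|\<close> has the
  eigenvalues \<open>s\<^sub>k\<close>, and the trace sums their powers.\<close>

lemma schatten_norm_eq:
  fixes s :: "nat \<Rightarrow> real"
  assumes V: "V \<in> carrier (unitary_group n)" and s: "\<And>k. s k \<ge> 0"
    and eq: "mat_adjoint A * A = V * mat_diag n (\<lambda>k. of_real ((s k)\<^sup>2)) * mat_adjoint V"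
  shows "schatten_norm p A = (\<Sum>k<n. s k powr p) powr (1 / p)"
proof -
  have "mat_abs A = V * mat_diag n (\<lambda>k. of_real (s k)) * mat_adjoint V"
    unfolding mat_abs_def eq herm_fun_unitary_diag[OF V] using s by simp
  then have "mat_trace (herm_fun (\<lambda>t. t powr p) (mat_abs A)) = of_real (\<Sum>k<n. s k powr p)"
    by (simp add: herm_fun_unitary_diag[OF V] mat_trace_unitary_diag[OF V])
  then show ?thesis unfolding schatten_norm_def by simp
qed

lemma orthonormal_unitary:
  assumes v: "orthonormal n n v"
  shows "Matrix.mat n n (\<lambda>(j, k). v k j) \<in> carrier (unitary_group n)" (is "?V \<in> _")
    and "i < n \<Longrightarrow> j < n \<Longrightarrow> (\<Sum>k<n. v k i * cnj (v k j)) = (if i = j then 1 else 0)"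
proof -
  have C: "?V \<in> carrier_mat n n" by simp
  have "mat_adjoint ?V * ?V = 1\<^sub>m n"
  proof (rule eq_matI)
    fix k l assume "k < dim_row (1\<^sub>m n :: complex mat)" "l < dim_col (1\<^sub>m n :: complex mat)"
    then have kl: "k < n" "l < n" by auto
    have "(mat_adjoint ?V * ?V) $$ (k, l) = (\<Sum>j<n. mat_adjoint ?V $$ (k, j) * ?V $$ (j, l))"
      using C kl by (intro mat_mult_index) auto
    also have "\<dots> = herm_inner n (v l) (v k)"
      using kl unfolding herm_inner_def by (intro sum.cong) (auto simp: mat_adjoint_index)
    also have "\<dots> = (1\<^sub>m n :: complex mat) $$ (k, l)" using kl v by (auto simp: orthonormal_def)
    finally show "(mat_adjoint ?V * ?V) $$ (k, l) = (1\<^sub>m n :: complex mat) $$ (k, l)" .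
  qed (use carrier_matD[OF mat_adjoint_carrier[OF C]] in auto)
  then have VV: "?V * mat_adjoint ?V = 1\<^sub>m n"
    using C mat_mult_left_right_inverse[of "mat_adjoint ?V" n ?V] by simp
  then show "?V \<in> carrier (unitary_group n)" by (simp add: unitary_group_def)
  assume ij: "i < n" "j < n"
  have "(?V * mat_adjoint ?V) $$ (i, j) = (\<Sum>k<n. ?V $$ (i, k) * mat_adjoint ?V $$ (k, j))"
    using C ij by (intro mat_mult_index) auto
  also have "\<dots> = (\<Sum>k<n. v k i * cnj (v k j))"
    using ij by (intro sum.cong) (auto simp: mat_adjoint_index)
  finally show "(\<Sum>k<n. v k i * cnj (v k j)) = (if i = j then 1 else 0)"
    unfolding VV using ij by simp
qed

text \<open>For an orthonormal basis \<open>v\<close> with orthogonal images, \<open>s\<^sub>k = |A v\<^sub>k|\<close> and \<open>u\<^sub>k = A v\<^sub>k / s\<^sub>k\<close> decompose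
  \<open>A\<close>. The same basis diagonalizes \<open>A\<^sup>* A\<close> with eigenvalues \<open>s\<^sub>k\<^sup>2\<close>.\<close>

lemma exists_svd:
  assumes A: "A \<in> carrier_mat n n"
  shows "\<exists>s u v. svd n (\<lambda>i j. A $$ (i, j)) s u v \<and>
    (\<forall>p. schatten_norm p A = (\<Sum>k<n. s k powr p) powr (1 / p))"
proof -
  let ?A = "\<lambda>i j. A $$ (i, j)"
  obtain v where v: "orthonormal n n v"
    and im: "\<And>k l. k < n \<Longrightarrow> l < n \<Longrightarrow> k \<noteq> l \<Longrightarrow> herm_inner n (mat_app n ?A (v k)) (mat_app n ?A (v l)) = 0"
    using exists_orthonormal_basis_orthogonal_images[of n ?A] by blast
  define s where "s = (\<lambda>k. sqrt (normsq n (mat_app n ?A (v k))))"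
  \<comment> \<open>If \<open>s k = 0\<close>, division by zero makes \<open>u k\<close> the zero vector.\<close>
  define u where "u = (\<lambda>k i. of_real (1 / s k) * mat_app n ?A (v k) i)"
  have s0: "s k \<ge> 0" for k by (simp add: s_def)
  have s2: "(s k)\<^sup>2 = normsq n (mat_app n ?A (v k))" for k by (simp add: s_def)
  have nu: "normsq n (u k) = (if s k = 0 then 0 else 1)" for k
    unfolding u_def normsq_scale s2[symmetric] norm_of_real by (auto simp: power_divide)
  have ipu: "herm_inner n (u k) (u l) = 0" if "k < n" "l < n" "k \<noteq> l" for k l
    unfolding u_def herm_inner_scale_left herm_inner_scale_right im[OF that] by simp
  have su: "of_real (s k) * u k i = mat_app n ?A (v k) i" if "i < n" for k i
  proof (cases "s k = 0")
    case True
    then have "mat_app n ?A (v k) i = 0" using that s2[of k] by (simp add: normsq_eq_0_iff)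
    then show ?thesis using True by simp
  qed (simp add: u_def)
  have dec: "?A i j = dyad_sum n (\<lambda>k. of_real (s k)) u v i j" if ij: "i < n" "j < n" for i j
  proof -
    have "dyad_sum n (\<lambda>k. of_real (s k)) u v i j = (\<Sum>k<n. \<Sum>l<n. A $$ (i, l) * (v k l * cnj (v k j)))"
      unfolding dyad_sum_def su[OF ij(1)] mat_app_def by (simp add: sum_distrib_right mult.assoc)
    also have "\<dots> = (\<Sum>l<n. A $$ (i, l) * (\<Sum>k<n. v k l * cnj (v k j)))"
      by (subst sum.swap) (simp add: sum_distrib_left)
    also have "\<dots> = (\<Sum>l<n. A $$ (i, l) * (if l = j then 1 else 0))"
      using orthonormal_unitary(2)[OF v _ ij(2)] by (intro sum.cong refl) auto
    also have "\<dots> = A $$ (i, j)" using ij by (simp add: if_distrib cong: if_cong)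
    finally show ?thesis by simp
  qed
  have svd: "svd n ?A s u v"
    unfolding svd_def orthofam_def
    using s0 ipu nu dec orthonormal_imp_orthofam[OF v] orthonormal_normsq[OF v] by (auto simp: orthofam_def)
  define V where "V = Matrix.mat n n (\<lambda>(j, k). v k j)"
  have V: "V \<in> carrier (unitary_group n)" unfolding V_def by (rule orthonormal_unitary(1)[OF v])
  note VC[simp] = unitaryD(1)[OF V]
  note A[simp]
  note square = assoc_mult_mat[of _ n n _ n _ n] mult_carrier_mat[of _ n n _ n]
    right_mult_one_mat[of _ n n] left_mult_one_mat[of _ n n]
  have AV: "(A * V) $$ (i, k) = mat_app n ?A (v k) i" if "i < n" "k < n" for i k
  proof -
    have "(A * V) $$ (i, k) = (\<Sum>j<n. A $$ (i, j) * V $$ (j, k))" using that by (intro mat_mult_index) auto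
    then show ?thesis using that by (simp add: mat_app_def V_def)
  qed
  have "mat_adjoint (A * V) * (A * V) = mat_diag n (\<lambda>k. of_real ((s k)\<^sup>2))"
  proof (rule eq_matI)
    fix k l assume "k < dim_row (mat_diag n (\<lambda>k. complex_of_real ((s k)\<^sup>2)))" "l < dim_col (mat_diag n (\<lambda>k. complex_of_real ((s k)\<^sup>2)))"
    then have kl: "k < n" "l < n" by (auto simp: mat_diag_def)
    have AVc: "A * V \<in> carrier_mat n n" by (rule mult_carrier_mat[OF A VC])
    have "(mat_adjoint (A * V) * (A * V)) $$ (k, l) = (\<Sum>j<n. mat_adjoint (A * V) $$ (k, j) * (A * V) $$ (j, l))"
      by (rule mat_mult_index[OF mat_adjoint_carrier[OF AVc] AVc kl])
    also have "\<dots> = herm_inner n (mat_app n ?A (v l)) (mat_app n ?A (v k))"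
      unfolding herm_inner_def using kl AVc
      by (intro sum.cong refl) (auto simp: mat_adjoint_index AV carrier_matD[OF A] carrier_matD[OF VC] simp del: index_mult_mat(1))
    also have "\<dots> = mat_diag n (\<lambda>k. of_real ((s k)\<^sup>2)) $$ (k, l)"
      using kl im by (auto simp: mat_diag_def herm_inner_self s2 simp del: of_real_power)
    finally show "(mat_adjoint (A * V) * (A * V)) $$ (k, l) = mat_diag n (\<lambda>k. of_real ((s k)\<^sup>2)) $$ (k, l)" .
  qed (use carrier_matD[OF mat_adjoint_carrier[OF mult_carrier_mat[OF A VC]]] carrier_matD[OF VC] in \<open>auto simp: mat_diag_def\<close>)
  then have "V * mat_diag n (\<lambda>k. of_real ((s k)\<^sup>2)) * mat_adjoint V
     = V * (mat_adjoint V * mat_adjoint A * (A * V)) * mat_adjoint V"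
    by (simp add: mat_adjoint_mult[OF A VC])
  also have "\<dots> = (V * mat_adjoint V) * (mat_adjoint A * A) * (V * mat_adjoint V)"
    by (simp add: square)
  also have "\<dots> = mat_adjoint A * A"
    using mult_carrier_mat[OF mat_adjoint_carrier[OF A] A]
    by (simp only: unitaryD(2)[OF V] left_mult_one_mat right_mult_one_mat)
  finally have "schatten_norm p A = (\<Sum>k<n. s k powr p) powr (1 / p)" for p
    by (intro schatten_norm_eq[OF V s0]) simp
  with svd show ?thesis by blast
qed

section \<open>Minkowski's inequality and sums over an arbitrary index set\<close>

text \<open>At \<open>x = 0\<close> or \<open>y = 0\<close> convexity of the power reduces to \<open>t\<^sup>s \<le> t\<close> for \<open>0 \<le> t \<le> 1\<close>; elsewhere it
  follows from the second derivative.\<close>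

lemma powr_convex_combination:
  fixes s t x y :: real
  assumes "s \<ge> 1" "0 \<le> t" "t \<le> 1" "x \<ge> 0" "y \<ge> 0"
  shows "(t * x + (1 - t) * y) powr s \<le> t * x powr s + (1 - t) * y powr s"
proof -
  have le: "t powr s \<le> t" if "0 \<le> t" "t \<le> 1" for t :: real
    using powr_mono'[of 1 s t] that assms by simp
  consider "x = 0" | "y = 0" | "x > 0" "y > 0" using assms by linarith
  then show ?thesis
  proof cases
    case 1
    then show ?thesis using assms le[of "1 - t"] by (simp add: powr_mult mult_right_mono)
  next
    case 2
    then show ?thesis using assms le[of t] by (simp add: powr_mult mult_right_mono)
  next
    case 3
    then show ?thesis
      using convex_onD[OF powr_convex[OF assms(1)], of t y x] assms by (simp add: add.commute)
  qed
qed

text \<open>With bounds \<open>m\<close>, \<open>m'\<close> in place of the norms: \<open>(f + g) / (m + m')\<close> is the convex combination of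
  \<open>f / m\<close> and \<open>g / m'\<close> with weight \<open>m / (m + m')\<close>.\<close>

lemma minkowski_sum:
  fixes f g :: "'i \<Rightarrow> real" and s m m' :: real
  assumes s: "s \<ge> 1" and fin: "finite I" and nonneg: "\<And>i. i \<in> I \<Longrightarrow> f i \<ge> 0" "\<And>i. i \<in> I \<Longrightarrow> g i \<ge> 0"
    and m: "m \<ge> 0" "(\<Sum>i\<in>I. f i powr s) \<le> m powr s" and m': "m' \<ge> 0" "(\<Sum>i\<in>I. g i powr s) \<le> m' powr s"
  shows "(\<Sum>i\<in>I. (f i + g i) powr s) \<le> (m + m') powr s"
proof -
  have zero: "h i = 0" if "(\<Sum>i\<in>I. h i powr s) \<le> 0" "i \<in> I" for h :: "'i \<Rightarrow> real" and i
  proof -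
    have "h i powr s \<le> (\<Sum>i\<in>I. h i powr s)" using fin that by (intro member_le_sum) auto
    then have "h i powr s = 0" using that(1) powr_ge_zero[of "h i" s] by linarith
    then show ?thesis by simp
  qed
  consider "m = 0" | "m' = 0" | "m > 0" "m' > 0" using m m' by linarith
  then show ?thesis
  proof cases
    case 1
    have "f i = 0" if "i \<in> I" for i by (rule zero[OF _ that]) (use m 1 in simp)
    then show ?thesis using m' 1 by simp
  next
    case 2
    have "g i = 0" if "i \<in> I" for i by (rule zero[OF _ that]) (use m' 2 in simp)
    then show ?thesis using m 2 by simp
  next
    case 3
    define t where "t = m / (m + m')"
    have t: "0 \<le> t" "t \<le> 1" "1 - t = m' / (m + m')" using 3 by (auto simp: t_def field_simps)
    have "(f i + g i) powr s \<le> (m + m') powr s * (t * (f i / m) powr s + (1 - t) * (g i / m') powr s)"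
      if i: "i \<in> I" for i
    proof -
      have "f i + g i = (m + m') * (t * (f i / m) + (1 - t) * (g i / m'))"
        unfolding t(3) using 3 by (simp add: t_def distrib_left)
      then have "(f i + g i) powr s = (m + m') powr s * (t * (f i / m) + (1 - t) * (g i / m')) powr s"
        using 3 by (simp add: powr_mult)
      also have "\<dots> \<le> (m + m') powr s * (t * (f i / m) powr s + (1 - t) * (g i / m') powr s)"
        using nonneg[OF i] 3 t s by (intro mult_left_mono powr_convex_combination) auto
      finally show ?thesis .
    qed
    then have "(\<Sum>i\<in>I. (f i + g i) powr s)
      \<le> (\<Sum>i\<in>I. (m + m') powr s * (t * (f i / m) powr s + (1 - t) * (g i / m') powr s))"
      by (rule sum_mono)
    also have "\<dots> = (m + m') powr s * (t * ((\<Sum>i\<in>I. f i powr s) / m powr s) + (1 - t) * ((\<Sum>i\<in>I. g i powr s) / m' powr s))"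
    proof -
      have "(\<Sum>i\<in>I. (f i / m) powr s) = (\<Sum>i\<in>I. f i powr s) / m powr s"
        "(\<Sum>i\<in>I. (g i / m') powr s) = (\<Sum>i\<in>I. g i powr s) / m' powr s"
        using nonneg 3 by (simp_all add: powr_divide sum_divide_distrib)
      then show ?thesis by (simp only: sum_distrib_left[symmetric] sum.distrib)
    qed
    also have "\<dots> \<le> (m + m') powr s * (t * 1 + (1 - t) * 1)"
      using m m' 3 t by (intro mult_left_mono add_mono) auto
    finally show ?thesis by simp
  qed
qed

text \<open>The triangle inequality for the norm \<open>(|a|\<^sup>r + |b|\<^sup>r)\<^bsup>1/r\<^esup>\<close> of the plane, applied once per summand.\<close>

lemma pair_minkowski_sum:
  fixes a b m :: "'i \<Rightarrow> real"
  assumes r: "r \<ge> 1" and "finite F"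
    and "\<And>c. c \<in> F \<Longrightarrow> a c \<ge> 0" "\<And>c. c \<in> F \<Longrightarrow> b c \<ge> 0" "\<And>c. c \<in> F \<Longrightarrow> m c \<ge> 0"
    and "\<And>c. c \<in> F \<Longrightarrow> a c powr r + b c powr r \<le> m c powr r"
  shows "(\<Sum>c\<in>F. a c) powr r + (\<Sum>c\<in>F. b c) powr r \<le> (\<Sum>c\<in>F. m c) powr r"
  using assms(2-)
proof (induction F rule: finite_induct)
  case (insert c F)
  \<comment> \<open>The index \<open>i\<close> ranges over \<open>bool\<close>: its two values are the coordinates of the plane.\<close>
  have "(\<Sum>i\<in>UNIV. ((if i then a c else b c) + (if i then \<Sum>c\<in>F. a c else \<Sum>c\<in>F. b c)) powr r)
     \<le> (m c + (\<Sum>c\<in>F. m c)) powr r"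
    using insert by (intro minkowski_sum r) (auto simp: UNIV_bool add.commute intro!: sum_nonneg)
  then show ?case using insert by (simp add: UNIV_bool add.commute)
qed simp

lemma infsum_ennreal_bounded:
  fixes a :: "'i \<Rightarrow> real"
  assumes nonneg: "\<And>c. c \<in> D \<Longrightarrow> a c \<ge> 0"
    and bound: "\<And>F. finite F \<Longrightarrow> F \<subseteq> D \<Longrightarrow> sum a F \<le> K"
  shows "\<exists>x\<ge>0. (\<Sum>\<^sub>\<infinity>c\<in>D. ennreal (a c)) = ennreal x \<and> (sum a \<longlongrightarrow> x) (finite_subsets_at_top D)"
proof -
  let ?S = "\<Sum>\<^sub>\<infinity>c\<in>D. ennreal (a c)"
  have sumF: "(\<Sum>c\<in>F. ennreal (a c)) = ennreal (sum a F)" if "F \<subseteq> D" for F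
    using nonneg that by (intro sum_ennreal) auto
  have ev: "eventually (\<lambda>F. finite F \<and> F \<subseteq> D) (finite_subsets_at_top D)"
    by (rule eventually_finite_subsets_at_top_weakI) auto
  have lim: "((\<lambda>F. \<Sum>c\<in>F. ennreal (a c)) \<longlongrightarrow> ?S) (finite_subsets_at_top D)"
    using has_sum_infsum[OF nonneg_summable_on_complete[of D "\<lambda>c. ennreal (a c)"]] by (simp add: has_sum_def)
  then have lim': "((\<lambda>F. ennreal (sum a F)) \<longlongrightarrow> ?S) (finite_subsets_at_top D)"
    by (rule Lim_transform_eventually) (use ev sumF in \<open>auto elim: eventually_mono\<close>)
  have "?S \<le> ennreal K"
    by (rule tendsto_upperbound[OF lim']) (use ev bound in \<open>auto elim!: eventually_mono intro!: ennreal_leI\<close>)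
  then obtain x where x: "x \<ge> 0" "?S = ennreal x" by (cases ?S) (auto simp: top_unique)
  moreover have "(sum a \<longlongrightarrow> x) (finite_subsets_at_top D)"
    using lim' x by (intro tendsto_ennrealD) (use ev nonneg in \<open>auto elim!: eventually_mono intro!: sum_nonneg\<close>)
  ultimately show ?thesis by blast
qed

lemma sum_le_infsum_ennreal:
  fixes a :: "'i \<Rightarrow> real"
  assumes nonneg: "\<And>c. c \<in> D \<Longrightarrow> a c \<ge> 0" and "(\<Sum>\<^sub>\<infinity>c\<in>D. ennreal (a c)) = ennreal x" "x \<ge> 0"
    and F: "finite F" "F \<subseteq> D"
  shows "sum a F \<le> x"
proof -
  have "ennreal (sum a F) = (\<Sum>c\<in>F. ennreal (a c))" using nonneg F by (intro sum_ennreal[symmetric]) auto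
  also have "\<dots> = (\<Sum>\<^sub>\<infinity>c\<in>F. ennreal (a c))" using F by simp
  also have "\<dots> \<le> ennreal x" unfolding assms(2)[symmetric]
    using F by (intro infsum_mono_neutral nonneg_summable_on_complete) auto
  finally show ?thesis using assms by simp
qed

text \<open>An inequality between two sums passes from finite subsets to the whole index set, because both
  sums are limits along the finite subsets. Finiteness of the limits is part of the conclusion.\<close>

lemma infsum_ennreal_pair_le:
  fixes a b :: "'i \<Rightarrow> real"
  assumes r: "r \<ge> 1" and nonneg: "\<And>c. c \<in> D \<Longrightarrow> a c \<ge> 0" "\<And>c. c \<in> D \<Longrightarrow> b c \<ge> 0"
    and le: "\<And>F. finite F \<Longrightarrow> F \<subseteq> D \<Longrightarrow> sum a F powr r + sum b F powr r \<le> K powr r" and K: "K \<ge> 0"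
  shows "\<exists>x\<ge>0. \<exists>y\<ge>0. (\<Sum>\<^sub>\<infinity>c\<in>D. ennreal (a c)) = ennreal x \<and> (\<Sum>\<^sub>\<infinity>c\<in>D. ennreal (b c)) = ennreal y
     \<and> x powr r + y powr r \<le> K powr r"
proof -
  have bound: "u \<le> K" if "u powr r + v powr r \<le> K powr r" for u v
  proof (rule ccontr)
    assume "\<not> u \<le> K"
    then have "K powr r < u powr r" using K r by (intro powr_less_mono2) auto
    then show False using that powr_ge_zero[of v r] by linarith
  qed
  obtain x where x: "x \<ge> 0" "(\<Sum>\<^sub>\<infinity>c\<in>D. ennreal (a c)) = ennreal x" "(sum a \<longlongrightarrow> x) (finite_subsets_at_top D)"
    using infsum_ennreal_bounded[OF nonneg(1) bound[OF le]] by blast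
  have le': "sum b F powr r + sum a F powr r \<le> K powr r" if "finite F" "F \<subseteq> D" for F
    using le[OF that] by linarith
  obtain y where y: "y \<ge> 0" "(\<Sum>\<^sub>\<infinity>c\<in>D. ennreal (b c)) = ennreal y" "(sum b \<longlongrightarrow> y) (finite_subsets_at_top D)"
    using infsum_ennreal_bounded[OF nonneg(2) bound[OF le']] by blast
  have ev: "eventually (\<lambda>F. finite F \<and> F \<subseteq> D) (finite_subsets_at_top D)"
    by (rule eventually_finite_subsets_at_top_weakI) auto
  have lim: "((\<lambda>F. sum a F powr r + sum b F powr r) \<longlongrightarrow> x powr r + y powr r) (finite_subsets_at_top D)"
    using ev r nonneg
    by (intro tendsto_add tendsto_powr' tendsto_const x(3) y(3) disjI2 conjI)
      (auto elim!: eventually_mono intro!: sum_nonneg)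
  have "x powr r + y powr r \<le> K powr r"
    by (rule tendsto_upperbound[OF lim]) (use ev le in \<open>auto elim!: eventually_mono\<close>)
  with x y show ?thesis by blast
qed

lemma ennreal_powr_ennreal: "x \<ge> 0 \<Longrightarrow> ennreal x powr\<^sub>e a = ennreal (x powr a)"
  by (simp add: ennreal_powr_def)

section \<open>Clarkson's inequalities on the dual\<close>

lemma svd_scale:
  assumes X: "svd n X s u v" and c: "c > 0" and XY: "\<And>i j. i < n \<Longrightarrow> j < n \<Longrightarrow> Y i j = of_real c * X i j"
  shows "svd n Y (\<lambda>k. c * s k) u v"
  using X c XY by (auto simp: svd_def dyad_sum_def sum_distrib_left mult.assoc)

lemma exists_svd_schatten_powr:
  assumes "A \<in> carrier_mat n n" and "p > 0"
  shows "\<exists>s u v. svd n (\<lambda>i j. A $$ (i, j)) s u v \<and> schatten_norm p A powr p = (\<Sum>k<n. s k powr p)"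
proof -
  obtain s u v where "svd n (\<lambda>i j. A $$ (i, j)) s u v" "schatten_norm p A = (\<Sum>k<n. s k powr p) powr (1 / p)"
    using exists_svd[OF assms(1)] by blast
  then show ?thesis using assms(2) by (intro exI[of _ s] exI[of _ u] exI[of _ v]) (simp add: powr_powr sum_nonneg)
qed

lemma sum_scaled_powr:
  fixes s :: "nat \<Rightarrow> real"
  shows "\<forall>k. s k \<ge> 0 \<Longrightarrow> (\<Sum>k<n. (2 * s k) powr p) = 2 powr p * (\<Sum>k<n. s k powr p)"
  by (simp add: powr_mult sum_distrib_left)

text \<open>The inequalities for singular values concern \<open>A + B\<close>, the norms to be estimated \<open>(A + B) / 2\<close>.
  Doubling the singular values of the latter gives a decomposition of the former; it contributes
  the factor \<open>2\<^sup>p\<close>.\<close>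

lemma exists_svd_half_sum:
  fixes A B :: "complex mat"
  assumes A: "A \<in> carrier_mat n n" and B: "B \<in> carrier_mat n n" and p: "p > 0"
  shows "\<exists>s u v. svd n (\<lambda>i j. A $$ (i, j) + B $$ (i, j)) s u v \<and>
      (\<Sum>k<n. s k powr p) = 2 powr p * schatten_norm p ((1 / 2) \<cdot>\<^sub>m (A + B)) powr p"
    and "\<exists>s u v. svd n (\<lambda>i j. A $$ (i, j) - B $$ (i, j)) s u v \<and>
      (\<Sum>k<n. s k powr p) = 2 powr p * schatten_norm p ((1 / 2) \<cdot>\<^sub>m (A - B)) powr p"
proof -
  have *: "\<exists>s u v. svd n (\<lambda>i j. M $$ (i, j)) s u v \<and>
      (\<Sum>k<n. s k powr p) = 2 powr p * schatten_norm p ((1 / 2) \<cdot>\<^sub>m M) powr p"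
    if M: "M \<in> carrier_mat n n" for M :: "complex mat"
  proof -
    have half: "(1 / 2) \<cdot>\<^sub>m M \<in> carrier_mat n n" using M by simp
    obtain s u v where s: "svd n (\<lambda>i j. ((1 / 2) \<cdot>\<^sub>m M) $$ (i, j)) s u v"
       "schatten_norm p ((1 / 2) \<cdot>\<^sub>m M) powr p = (\<Sum>k<n. s k powr p)"
      using exists_svd_schatten_powr[OF half p] by blast
    have "svd n (\<lambda>i j. M $$ (i, j)) (\<lambda>k. 2 * s k) u v"
      by (rule svd_scale[OF s(1)]) (use M in auto)
    moreover have "(\<Sum>k<n. (2 * s k) powr p) = 2 powr p * schatten_norm p ((1 / 2) \<cdot>\<^sub>m M) powr p"
      unfolding s(2) using s(1) by (intro sum_scaled_powr) (simp add: svd_def)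
    ultimately show ?thesis by blast
  qed
  have cong: "svd n X s u v \<longleftrightarrow> svd n Y s u v" if "\<And>i j. i < n \<Longrightarrow> j < n \<Longrightarrow> X i j = Y i j" for X Y s u v
    using that by (auto simp: svd_def)
  have "svd n (\<lambda>i j. (A + B) $$ (i, j)) s u v \<longleftrightarrow> svd n (\<lambda>i j. A $$ (i, j) + B $$ (i, j)) s u v" for s u v
    using A B by (intro cong) auto
  then show "\<exists>s u v. svd n (\<lambda>i j. A $$ (i, j) + B $$ (i, j)) s u v \<and>
      (\<Sum>k<n. s k powr p) = 2 powr p * schatten_norm p ((1 / 2) \<cdot>\<^sub>m (A + B)) powr p"
    using *[OF add_carrier_mat[OF B, of A]] by simp
  have "svd n (\<lambda>i j. (A - B) $$ (i, j)) s u v \<longleftrightarrow> svd n (\<lambda>i j. A $$ (i, j) - B $$ (i, j)) s u v" for s u v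
    using A B by (intro cong) auto
  then show "\<exists>s u v. svd n (\<lambda>i j. A $$ (i, j) - B $$ (i, j)) s u v \<and>
      (\<Sum>k<n. s k powr p) = 2 powr p * schatten_norm p ((1 / 2) \<cdot>\<^sub>m (A - B)) powr p"
    using *[OF minus_carrier_mat[OF B, of A]] by simp
qed

text \<open>The constants fit because \<open>q - 1 = q/p\<close>: halving the matrices contributes \<open>2\<^sup>-\<^sup>q\<close>, and with the
  factor \<open>2\<close> of the inequality for singular values this is the factor \<open>2\<^bsup>-q/p\<^esup>\<close> on the right.\<close>

lemma schatten_clarkson_le_2:
  fixes p q :: real and A B :: "complex mat"
  assumes p: "1 < p" "p \<le> 2" and pq: "1 / p + 1 / q = 1" "q > 1"
    and A: "A \<in> carrier_mat n n" and B: "B \<in> carrier_mat n n"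
  shows "(schatten_norm p ((1 / 2) \<cdot>\<^sub>m (A + B)) powr p) powr (q / p)
      + (schatten_norm p ((1 / 2) \<cdot>\<^sub>m (A - B)) powr p) powr (q / p)
    \<le> ((schatten_norm p A powr p + schatten_norm p B powr p) / 2) powr (q / p)"
proof -
  have p0: "p > 0" using p by simp
  let ?a = "schatten_norm p ((1 / 2) \<cdot>\<^sub>m (A + B)) powr p"
  let ?b = "schatten_norm p ((1 / 2) \<cdot>\<^sub>m (A - B)) powr p"
  obtain \<alpha> u v where a: "svd n (\<lambda>i j. A $$ (i, j)) \<alpha> u v" "schatten_norm p A powr p = (\<Sum>k<n. \<alpha> k powr p)"
    using exists_svd_schatten_powr[OF A p0] by blast
  obtain \<beta> u' v' where b: "svd n (\<lambda>i j. B $$ (i, j)) \<beta> u' v'" "schatten_norm p B powr p = (\<Sum>k<n. \<beta> k powr p)"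
    using exists_svd_schatten_powr[OF B p0] by blast
  obtain \<gamma> e f where c: "svd n (\<lambda>i j. A $$ (i, j) + B $$ (i, j)) \<gamma> e f" "(\<Sum>k<n. \<gamma> k powr p) = 2 powr p * ?a"
    using exists_svd_half_sum(1)[OF A B p0] by blast
  obtain \<delta> e' f' where d: "svd n (\<lambda>i j. A $$ (i, j) - B $$ (i, j)) \<delta> e' f'" "(\<Sum>k<n. \<delta> k powr p) = 2 powr p * ?b"
    using exists_svd_half_sum(2)[OF A B p0] by blast
  have "(2 powr p * ?a) powr (q / p) + (2 powr p * ?b) powr (q / p)
    \<le> 2 * (schatten_norm p A powr p + schatten_norm p B powr p) powr (q / p)"
    using clarkson_svd_le_2[OF p pq a(1) b(1) c(1) d(1)] unfolding a(2) b(2) c(2) d(2) .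
  then have "2 powr q * (?a powr (q / p) + ?b powr (q / p))
    \<le> 2 * (schatten_norm p A powr p + schatten_norm p B powr p) powr (q / p)"
    using p0 by (simp add: powr_mult powr_powr distrib_left)
  moreover have "2 powr q = 2 * 2 powr (q / p)"
  proof -
    have "q = 1 + q / p" using pq p0 by (simp add: field_simps)
    then have "2 powr q = 2 powr (1 + q / p)" by simp
    then show ?thesis by (simp only: powr_add) simp
  qed
  ultimately have "2 powr (q / p) * (?a powr (q / p) + ?b powr (q / p))
    \<le> (schatten_norm p A powr p + schatten_norm p B powr p) powr (q / p)" by simp
  then show ?thesis by (subst powr_divide) (auto simp: field_simps)
qed

text \<open>The inequality for singular values is used with \<open>p\<close> and \<open>q\<close> exchanged; the constants fit because
  \<open>p - 1 = p/q\<close>.\<close>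

lemma schatten_clarkson_ge_2:
  fixes p q :: real and A B :: "complex mat"
  assumes p: "2 \<le> p" and pq: "1 / p + 1 / q = 1" "q > 1"
    and A: "A \<in> carrier_mat n n" and B: "B \<in> carrier_mat n n"
  shows "schatten_norm p ((1 / 2) \<cdot>\<^sub>m (A + B)) powr p + schatten_norm p ((1 / 2) \<cdot>\<^sub>m (A - B)) powr p
    \<le> (((schatten_norm p A powr p) powr (q / p) + (schatten_norm p B powr p) powr (q / p)) / 2) powr (p / q)"
proof -
  have p0: "p > 0" using p by simp
  have p1: "p > 1" using p by simp
  have q2: "q \<le> 2"
  proof -
    have "1 / p \<le> 1 / 2" using p by (intro frac_le) auto
    then have "1 / 2 \<le> 1 / q" using pq by linarith
    then show ?thesis using pq(2) by (simp add: field_simps)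
  qed
  have qp: "1 / q + 1 / p = 1" using pq by simp
  let ?a = "schatten_norm p ((1 / 2) \<cdot>\<^sub>m (A + B)) powr p"
  let ?b = "schatten_norm p ((1 / 2) \<cdot>\<^sub>m (A - B)) powr p"
  let ?N = "(schatten_norm p A powr p) powr (q / p) + (schatten_norm p B powr p) powr (q / p)"
  obtain \<alpha> u v where a: "svd n (\<lambda>i j. A $$ (i, j)) \<alpha> u v" "schatten_norm p A powr p = (\<Sum>k<n. \<alpha> k powr p)"
    using exists_svd_schatten_powr[OF A p0] by blast
  obtain \<beta> u' v' where b: "svd n (\<lambda>i j. B $$ (i, j)) \<beta> u' v'" "schatten_norm p B powr p = (\<Sum>k<n. \<beta> k powr p)"
    using exists_svd_schatten_powr[OF B p0] by blast
  obtain \<gamma> e f where c: "svd n (\<lambda>i j. A $$ (i, j) + B $$ (i, j)) \<gamma> e f" "(\<Sum>k<n. \<gamma> k powr p) = 2 powr p * ?a"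
    using exists_svd_half_sum(1)[OF A B p0] by blast
  obtain \<delta> e' f' where d: "svd n (\<lambda>i j. A $$ (i, j) - B $$ (i, j)) \<delta> e' f'" "(\<Sum>k<n. \<delta> k powr p) = 2 powr p * ?b"
    using exists_svd_half_sum(2)[OF A B p0] by blast
  have "2 powr p * ?a + 2 powr p * ?b \<le> 2 * ?N powr (p / q)"
    using clarkson_svd_ge_2[OF pq(2) q2 qp p1 a(1) b(1) c(1) d(1)] unfolding a(2) b(2) c(2) d(2) .
  moreover have "2 powr p = 2 * 2 powr (p / q)"
  proof -
    have "p = 1 + p / q" using pq p0 by (simp add: field_simps)
    then have "2 powr p = 2 powr (1 + p / q)" by simp
    then show ?thesis by (simp only: powr_add) simp
  qed
  ultimately have "2 powr (p / q) * (?a + ?b) \<le> ?N powr (p / q)" by (simp add: distrib_left)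
  then show ?thesis by (subst powr_divide) (auto simp: field_simps)
qed

text \<open>In the application \<open>w\<close> is the dimension, \<open>r = q/p\<close>, and the other families are the \<open>p\<close>-th powers of
  the Schatten norms of the blocks. The weights enter linearly, so they may be multiplied into each
  block inequality before the triangle inequality in the plane is applied.\<close>

lemma weighted_clarkson_le_2:
  fixes w a b \<alpha> \<beta> :: "'i \<Rightarrow> real"
  assumes r: "r \<ge> 1"
    and nonneg: "\<And>c. w c \<ge> 0" "\<And>c. a c \<ge> 0" "\<And>c. b c \<ge> 0" "\<And>c. \<alpha> c \<ge> 0" "\<And>c. \<beta> c \<ge> 0"
    and le: "\<And>c. c \<in> D \<Longrightarrow> a c powr r + b c powr r \<le> ((\<alpha> c + \<beta> c) / 2) powr r"
    and S: "(\<Sum>\<^sub>\<infinity>c\<in>D. ennreal (w c * \<alpha> c)) = ennreal s" "s \<ge> 0" "(\<Sum>\<^sub>\<infinity>c\<in>D. ennreal (w c * \<beta> c)) = ennreal t" "t \<ge> 0"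
  shows "\<exists>x\<ge>0. \<exists>y\<ge>0. (\<Sum>\<^sub>\<infinity>c\<in>D. ennreal (w c * a c)) = ennreal x \<and> (\<Sum>\<^sub>\<infinity>c\<in>D. ennreal (w c * b c)) = ennreal y
     \<and> x powr r + y powr r \<le> ((s + t) / 2) powr r"
proof (rule infsum_ennreal_pair_le[OF r])
  fix F assume F: "finite F" "F \<subseteq> D"
  have "(\<Sum>c\<in>F. w c * a c) powr r + (\<Sum>c\<in>F. w c * b c) powr r \<le> (\<Sum>c\<in>F. w c * ((\<alpha> c + \<beta> c) / 2)) powr r"
  proof (rule pair_minkowski_sum[OF r F(1)])
    fix c assume "c \<in> F"
    then have "w c powr r * (a c powr r + b c powr r) \<le> w c powr r * ((\<alpha> c + \<beta> c) / 2) powr r"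
      using F le by (intro mult_left_mono) auto
    then show "(w c * a c) powr r + (w c * b c) powr r \<le> (w c * ((\<alpha> c + \<beta> c) / 2)) powr r"
      using nonneg by (simp only: powr_mult distrib_left)
  qed (use nonneg in auto)
  also have "(\<Sum>c\<in>F. w c * ((\<alpha> c + \<beta> c) / 2)) = ((\<Sum>c\<in>F. w c * \<alpha> c) + (\<Sum>c\<in>F. w c * \<beta> c)) / 2"
    by (simp add: sum.distrib distrib_left sum_divide_distrib add_divide_distrib)
  also have "\<dots> powr r \<le> ((s + t) / 2) powr r"
    using r nonneg S F
    by (intro powr_mono2 divide_right_mono add_mono sum_le_infsum_ennreal[of D]) (auto intro!: add_nonneg_nonneg sum_nonneg)
  finally show "(\<Sum>c\<in>F. w c * a c) powr r + (\<Sum>c\<in>F. w c * b c) powr r \<le> ((s + t) / 2) powr r" .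
qed (use nonneg S in auto)

text \<open>The same roles with \<open>r = p/q\<close>. The bound of a block is the \<open>r\<close>-th power of \<open>(f + g) / 2\<close> with
  \<open>f = (w \<alpha>)\<^bsup>1/r\<^esup>\<close>, \<open>g = (w \<beta>)\<^bsup>1/r\<^esup>\<close>, so Minkowski's inequality for two functions applies.\<close>

lemma weighted_clarkson_ge_2:
  fixes w a b \<alpha> \<beta> :: "'i \<Rightarrow> real"
  assumes r: "r \<ge> 1"
    and nonneg: "\<And>c. w c \<ge> 0" "\<And>c. a c \<ge> 0" "\<And>c. b c \<ge> 0" "\<And>c. \<alpha> c \<ge> 0" "\<And>c. \<beta> c \<ge> 0"
    and le: "\<And>c. c \<in> D \<Longrightarrow> a c + b c \<le> ((\<alpha> c powr (1 / r) + \<beta> c powr (1 / r)) / 2) powr r"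
    and S: "(\<Sum>\<^sub>\<infinity>c\<in>D. ennreal (w c * \<alpha> c)) = ennreal s" "s \<ge> 0" "(\<Sum>\<^sub>\<infinity>c\<in>D. ennreal (w c * \<beta> c)) = ennreal t" "t \<ge> 0"
  shows "\<exists>x\<ge>0. \<exists>y\<ge>0. (\<Sum>\<^sub>\<infinity>c\<in>D. ennreal (w c * a c)) = ennreal x \<and> (\<Sum>\<^sub>\<infinity>c\<in>D. ennreal (w c * b c)) = ennreal y
     \<and> x + y \<le> ((s powr (1 / r) + t powr (1 / r)) / 2) powr r"
proof -
  let ?K = "((s powr (1 / r) + t powr (1 / r)) / 2) powr r"
  have "\<exists>x\<ge>0. \<exists>y\<ge>0. (\<Sum>\<^sub>\<infinity>c\<in>D. ennreal (w c * a c)) = ennreal x \<and> (\<Sum>\<^sub>\<infinity>c\<in>D. ennreal (w c * b c)) = ennreal y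
     \<and> x powr 1 + y powr 1 \<le> ?K powr 1"
  proof (rule infsum_ennreal_pair_le)
    fix F assume F: "finite F" "F \<subseteq> D"
    define f where "f = (\<lambda>c. (w c * \<alpha> c) powr (1 / r))"
    define g where "g = (\<lambda>c. (w c * \<beta> c) powr (1 / r))"
    have half_sum: "(\<Sum>c\<in>F. ((w c * \<phi> c) powr (1 / r) / 2) powr r) \<le> (z powr (1 / r) / 2) powr r"
      if \<phi>: "\<And>c. \<phi> c \<ge> 0" and z: "(\<Sum>\<^sub>\<infinity>c\<in>D. ennreal (w c * \<phi> c)) = ennreal z" "z \<ge> 0" for \<phi> z
    proof -
      have "(\<Sum>c\<in>F. ((w c * \<phi> c) powr (1 / r) / 2) powr r) = (\<Sum>c\<in>F. w c * \<phi> c) / 2 powr r"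
        using r nonneg \<phi> by (simp add: powr_divide powr_powr sum_divide_distrib)
      also have "\<dots> \<le> z / 2 powr r"
        using nonneg \<phi> z F by (intro divide_right_mono sum_le_infsum_ennreal[of D]) auto
      also have "\<dots> = (z powr (1 / r) / 2) powr r" using r z by (simp add: powr_divide powr_powr)
      finally show ?thesis .
    qed
    have "(\<Sum>c\<in>F. (f c / 2 + g c / 2) powr r) \<le> (s powr (1 / r) / 2 + t powr (1 / r) / 2) powr r"
      by (rule minkowski_sum[OF r F(1)]) (auto simp: f_def g_def intro!: half_sum nonneg S)
    moreover have "w c * a c + w c * b c \<le> (f c / 2 + g c / 2) powr r" if "c \<in> F" for c
    proof -
      have "w c * (a c + b c) \<le> w c * ((\<alpha> c powr (1 / r) + \<beta> c powr (1 / r)) / 2) powr r"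
        using that F le nonneg by (intro mult_left_mono) auto
      also have "\<dots> = (w c powr (1 / r)) powr r * ((\<alpha> c powr (1 / r) + \<beta> c powr (1 / r)) / 2) powr r"
        using r nonneg by (simp add: powr_powr)
      also have "\<dots> = (w c powr (1 / r) * ((\<alpha> c powr (1 / r) + \<beta> c powr (1 / r)) / 2)) powr r"
        by (simp only: powr_mult[symmetric] powr_ge_zero divide_nonneg_nonneg add_nonneg_nonneg zero_le_numeral)
      also have "w c powr (1 / r) * ((\<alpha> c powr (1 / r) + \<beta> c powr (1 / r)) / 2) = f c / 2 + g c / 2"
        using nonneg by (simp add: f_def g_def powr_mult field_simps)
      finally show ?thesis by (simp add: distrib_left)
    qed
    then have "(\<Sum>c\<in>F. w c * a c) + (\<Sum>c\<in>F. w c * b c) \<le> (\<Sum>c\<in>F. (f c / 2 + g c / 2) powr r)"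
      unfolding sum.distrib[symmetric] by (rule sum_mono)
    ultimately show "(\<Sum>c\<in>F. w c * a c) powr 1 + (\<Sum>c\<in>F. w c * b c) powr 1 \<le> ?K powr 1"
      using nonneg by (simp add: sum_nonneg add_divide_distrib)
  qed (use nonneg in auto)
  then obtain x y where xy: "x \<ge> 0" "y \<ge> 0" "(\<Sum>\<^sub>\<infinity>c\<in>D. ennreal (w c * a c)) = ennreal x"
    "(\<Sum>\<^sub>\<infinity>c\<in>D. ennreal (w c * b c)) = ennreal y" "x powr 1 + y powr 1 \<le> ?K powr 1" by blast
  then have "x + y \<le> ?K" by simp
  with xy show ?thesis by blast
qed

theorem proposition3p5:
  fixes G :: "('g, 'm) monoid_scheme" and T :: "'g topology"
    and \<rho> :: "('g \<Rightarrow> complex mat) set \<Rightarrow> ('g \<Rightarrow> complex mat)"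
    and p q :: real and H\<^sub>1 H\<^sub>2 :: "'g dual_map"
  assumes "compact_topological_group G T"
    and "rep_choice G T \<rho>"
    and "1 < p" and "1 < q" and "1 / p + 1 / q = 1"
    and "H\<^sub>1 \<in> lsch G T \<rho> p" and "H\<^sub>2 \<in> lsch G T \<rho> p"
  shows "(p \<le> 2 \<longrightarrow>
      (lsch_norm G T \<rho> p (dual_scale G T (1 / 2) (dual_add G T H\<^sub>1 H\<^sub>2)) powr\<^sub>e q
       + lsch_norm G T \<rho> p (dual_scale G T (1 / 2) (dual_diff G T H\<^sub>1 H\<^sub>2)) powr\<^sub>e q) powr\<^sub>e (1 / q)
      \<le> (1 / 2 * (lsch_norm G T \<rho> p H\<^sub>1 powr\<^sub>e p + lsch_norm G T \<rho> p H\<^sub>2 powr\<^sub>e p)) powr\<^sub>e (1 / p)) \<and>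
    (2 \<le> p \<longrightarrow>
      (lsch_norm G T \<rho> p (dual_scale G T (1 / 2) (dual_add G T H\<^sub>1 H\<^sub>2)) powr\<^sub>e p
       + lsch_norm G T \<rho> p (dual_scale G T (1 / 2) (dual_diff G T H\<^sub>1 H\<^sub>2)) powr\<^sub>e p) powr\<^sub>e (1 / p)
      \<le> (1 / 2 * (lsch_norm G T \<rho> p H\<^sub>1 powr\<^sub>e q + lsch_norm G T \<rho> p H\<^sub>2 powr\<^sub>e q)) powr\<^sub>e (1 / q))"
proof -
  note p = \<open>1 < p\<close> and q = \<open>1 < q\<close> and pq = \<open>1 / p + 1 / q = 1\<close>
  let ?D = "unitary_dual G T"
  define w where "w = (\<lambda>c. real (rep_dim G (\<rho> c)))"
  define nrm where "nrm = (\<lambda>H :: 'g dual_map. \<lambda>c. schatten_norm p (H c) powr p)"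
  define P where "P = dual_scale G T (1 / 2) (dual_add G T H\<^sub>1 H\<^sub>2)"
  define M where "M = dual_scale G T (1 / 2) (dual_diff G T H\<^sub>1 H\<^sub>2)"
  have norm_eq: "lsch_norm G T \<rho> p H = (\<Sum>\<^sub>\<infinity>c\<in>?D. ennreal (w c * nrm H c)) powr\<^sub>e (1 / p)" for H
    unfolding lsch_norm_def w_def nrm_def by (simp add: ennreal_mult' ennreal_of_nat_eq_real_of_nat)
  have finite_norm: "\<exists>s\<ge>0. (\<Sum>\<^sub>\<infinity>c\<in>?D. ennreal (w c * nrm H c)) = ennreal s" if "H \<in> lsch G T \<rho> p" for H
  proof -
    have "(\<Sum>\<^sub>\<infinity>c\<in>?D. ennreal (w c * nrm H c)) \<noteq> \<infinity>"
      using that unfolding lsch_def norm_eq by (auto simp: ennreal_powr_def split: if_splits)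
    then show ?thesis by (cases "\<Sum>\<^sub>\<infinity>c\<in>?D. ennreal (w c * nrm H c)") auto
  qed
  obtain s where s: "s \<ge> 0" "(\<Sum>\<^sub>\<infinity>c\<in>?D. ennreal (w c * nrm H\<^sub>1 c)) = ennreal s"
    using finite_norm[OF \<open>H\<^sub>1 \<in> lsch G T \<rho> p\<close>] by blast
  obtain t where t: "t \<ge> 0" "(\<Sum>\<^sub>\<infinity>c\<in>?D. ennreal (w c * nrm H\<^sub>2 c)) = ennreal t"
    using finite_norm[OF \<open>H\<^sub>2 \<in> lsch G T \<rho> p\<close>] by blast
  have carrier: "H\<^sub>1 c \<in> carrier_mat (rep_dim G (\<rho> c)) (rep_dim G (\<rho> c))"
     "H\<^sub>2 c \<in> carrier_mat (rep_dim G (\<rho> c)) (rep_dim G (\<rho> c))" if "c \<in> ?D" for c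
    using \<open>H\<^sub>1 \<in> lsch G T \<rho> p\<close> \<open>H\<^sub>2 \<in> lsch G T \<rho> p\<close> that by (auto simp: lsch_def dual_maps_def)
  have PM: "P c = (1 / 2) \<cdot>\<^sub>m (H\<^sub>1 c + H\<^sub>2 c)" "M c = (1 / 2) \<cdot>\<^sub>m (H\<^sub>1 c - H\<^sub>2 c)" if "c \<in> ?D" for c
    using that by (auto simp: P_def M_def dual_scale_def dual_add_def dual_diff_def)
  have half: "(1 / 2 :: ennreal) * ennreal x = ennreal (x / 2)" for x
  proof -
    have "(1 / 2 :: ennreal) = ennreal (1 / 2)" using divide_ennreal[of 1 2] by simp
    moreover have "ennreal (x / 2) = ennreal (1 / 2) * ennreal x"
      by (subst ennreal_mult'[symmetric]) auto
    ultimately show ?thesis by (simp only:)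
  qed
  have nn: "w c \<ge> 0" "nrm H c \<ge> 0" for c H by (auto simp: w_def nrm_def)
  show ?thesis unfolding P_def[symmetric] M_def[symmetric] norm_eq s(2) t(2)
  proof (intro conjI impI)
    assume p2: "p \<le> 2"
    have "p \<le> q"
    proof -
      have "1 / 2 \<le> 1 / p" using p p2 by (intro frac_le) auto
      then have "1 / q \<le> 1 / p" using pq by linarith
      then show ?thesis using p q by (simp add: field_simps)
    qed
    then have r: "q / p \<ge> 1" using p by simp
    have "nrm P c powr (q / p) + nrm M c powr (q / p) \<le> ((nrm H\<^sub>1 c + nrm H\<^sub>2 c) / 2) powr (q / p)" if "c \<in> ?D" for c
      unfolding nrm_def PM[OF that] by (rule schatten_clarkson_le_2[OF p p2 pq q carrier[OF that]])
    from weighted_clarkson_le_2[OF r nn(1) nn(2) nn(2) nn(2) nn(2) this s(2) s(1) t(2) t(1)]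
    obtain x y where xy: "x \<ge> 0" "y \<ge> 0" "(\<Sum>\<^sub>\<infinity>c\<in>?D. ennreal (w c * nrm P c)) = ennreal x"
      "(\<Sum>\<^sub>\<infinity>c\<in>?D. ennreal (w c * nrm M c)) = ennreal y" "x powr (q / p) + y powr (q / p) \<le> ((s + t) / 2) powr (q / p)"
      by blast
    have "(x powr (q / p) + y powr (q / p)) powr (1 / q) \<le> (((s + t) / 2) powr (q / p)) powr (1 / q)"
      using xy q by (intro powr_mono2) auto
    then have "(x powr (q / p) + y powr (q / p)) powr (1 / q) \<le> ((s + t) / 2) powr (1 / p)"
      using q by (simp add: powr_powr)
    then show "(((\<Sum>\<^sub>\<infinity>c\<in>?D. ennreal (w c * nrm P c)) powr\<^sub>e (1 / p)) powr\<^sub>e q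
        + ((\<Sum>\<^sub>\<infinity>c\<in>?D. ennreal (w c * nrm M c)) powr\<^sub>e (1 / p)) powr\<^sub>e q) powr\<^sub>e (1 / q)
      \<le> (1 / 2 * ((ennreal s powr\<^sub>e (1 / p)) powr\<^sub>e p + (ennreal t powr\<^sub>e (1 / p)) powr\<^sub>e p)) powr\<^sub>e (1 / p)"
      unfolding xy(3,4) using p xy s t
      by (simp add: ennreal_powr_ennreal powr_powr half ennreal_leI flip: ennreal_plus)
  next
    assume p2: "2 \<le> p"
    have "q \<le> p"
    proof -
      have "1 / p \<le> 1 / 2" using p2 by (intro frac_le) auto
      then have "1 / p \<le> 1 / q" using pq by linarith
      then show ?thesis using p q by (simp add: field_simps)
    qed
    then have r: "p / q \<ge> 1" using q by simp
    have "nrm P c + nrm M c \<le> ((nrm H\<^sub>1 c powr (1 / (p / q)) + nrm H\<^sub>2 c powr (1 / (p / q))) / 2) powr (p / q)" if "c \<in> ?D" for c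
      unfolding nrm_def PM[OF that] using schatten_clarkson_ge_2[OF p2 pq q carrier[OF that]] by simp
    from weighted_clarkson_ge_2[OF r nn(1) nn(2) nn(2) nn(2) nn(2) this s(2) s(1) t(2) t(1)]
    obtain x y where xy: "x \<ge> 0" "y \<ge> 0" "(\<Sum>\<^sub>\<infinity>c\<in>?D. ennreal (w c * nrm P c)) = ennreal x"
      "(\<Sum>\<^sub>\<infinity>c\<in>?D. ennreal (w c * nrm M c)) = ennreal y" "x + y \<le> ((s powr (q / p) + t powr (q / p)) / 2) powr (p / q)"
      by auto
    have "(x + y) powr (1 / p) \<le> (((s powr (q / p) + t powr (q / p)) / 2) powr (p / q)) powr (1 / p)"
      using xy p by (intro powr_mono2) auto
    then have "(x + y) powr (1 / p) \<le> ((s powr (q / p) + t powr (q / p)) / 2) powr (1 / q)"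
      using p by (simp add: powr_powr)
    then show "(((\<Sum>\<^sub>\<infinity>c\<in>?D. ennreal (w c * nrm P c)) powr\<^sub>e (1 / p)) powr\<^sub>e p
        + ((\<Sum>\<^sub>\<infinity>c\<in>?D. ennreal (w c * nrm M c)) powr\<^sub>e (1 / p)) powr\<^sub>e p) powr\<^sub>e (1 / p)
      \<le> (1 / 2 * ((ennreal s powr\<^sub>e (1 / p)) powr\<^sub>e q + (ennreal t powr\<^sub>e (1 / p)) powr\<^sub>e q)) powr\<^sub>e (1 / q)"
      unfolding xy(3,4) using p xy s t
      by (simp add: ennreal_powr_ennreal powr_powr half ennreal_leI flip: ennreal_plus)
  qed
qed

end
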